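(* Let $\mathfrak{H}$ be a complex separable Hilbert space of infinite dimension, let $T$ be a bounded self-adjoint operator on $\mathfrak{H}$, and let $S$ be a self-adjoint operator of finite rank $N$ on $\mathfrak{H}$. For $\lambda\in\mathbb{R}$ put $D(\lambda)=E_{(-\infty,\lambda)}(T+S)-E_{(-\infty,\lambda)}(T)$. Then for all $\lambda\in\mathbb{R}$, one has $$\dim\mathrm{Ker}\big(D(\lambda)\pm I\big)\le N,$$ i.e. both $\dim\mathrm{Ker}(D(\lambda)-I)\le N$ and $\dim\mathrm{Ker}(D(\lambda)+I)\le N$.
   Context: $E_\Omega(X)$ denotes the spectral projection of a self-adjoint operator $X$ associated with the Borel set $\Omega\subset\mathbb{R}$; $I$ is the identity operator. *)

theory Defs
  imports "HOL-Analysis.Analysis"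
begin

text \<open>
  The inner product is linear in the first argument. The last axiom says that the given
  norm is the one induced by the inner product; in particular it makes the inner product
  positive definite.
\<close>

class complex_hilbert_space = banach +
  fixes scaleC :: "complex \<Rightarrow> 'a \<Rightarrow> 'a" (infixr "*\<^sub>C" 75)
    and cinner :: "'a \<Rightarrow> 'a \<Rightarrow> complex"
  assumes scaleC_add_right: "a *\<^sub>C (x + y) = a *\<^sub>C x + a *\<^sub>C y"
    and scaleC_add_left: "(a + b) *\<^sub>C x = a *\<^sub>C x + b *\<^sub>C x"
    and scaleC_scaleC: "a *\<^sub>C (b *\<^sub>C x) = (a * b) *\<^sub>C x"
    and scaleC_of_real: "complex_of_real r *\<^sub>C x = r *\<^sub>R x"
    and cinner_add_left: "cinner (x + y) z = cinner x z + cinner y z"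
    and cinner_scaleC_left: "cinner (a *\<^sub>C x) y = a * cinner x y"
    and cinner_commute: "cinner x y = cnj (cinner y x)"
    and cinner_self: "cinner x x = complex_of_real ((norm x)\<^sup>2)"

interpretation cplx: vector_space "scaleC :: complex \<Rightarrow> 'a \<Rightarrow> 'a::complex_hilbert_space"
proof
  fix x :: 'a
  show "1 *\<^sub>C x = x"
    using scaleC_of_real[of 1 x] by simp
qed (simp_all add: scaleC_add_right scaleC_add_left scaleC_scaleC)

text \<open>
  The library dimension is 0 on infinite-dimensional subspaces, so bounds on it
  have to be accompanied by finite dimensionality.
\<close>

definition finite_cdim :: "'a::complex_hilbert_space set \<Rightarrow> bool" where
  "finite_cdim V \<longleftrightarrow> (\<exists>B. finite B \<and> V \<subseteq> cplx.span B)"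

definition cdim_le :: "'a::complex_hilbert_space set \<Rightarrow> nat \<Rightarrow> bool" where
  "cdim_le V n \<longleftrightarrow> finite_cdim V \<and> cplx.dim V \<le> n"

definition has_finite_rank :: "('a::complex_hilbert_space \<Rightarrow> 'a) \<Rightarrow> nat \<Rightarrow> bool" where
  "has_finite_rank A n \<longleftrightarrow> finite_cdim (range A) \<and> cplx.dim (range A) = n"

definition Ker :: "('a::complex_hilbert_space \<Rightarrow> 'a) \<Rightarrow> 'a set" where
  "Ker A = {x. A x = 0}"

text \<open>
  Operators are defined on the whole space, so self-adjointness is symmetry
  (and boundedness is automatic by the Hellinger-Toeplitz theorem).
\<close>

definition self_adjoint :: "('a::complex_hilbert_space \<Rightarrow> 'a) \<Rightarrow> bool" where
  "self_adjoint A \<longleftrightarrow>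
     Vector_Spaces.linear scaleC scaleC A \<and> (\<forall>x y. cinner (A x) y = cinner x (A y))"

definition orthogonal_projection :: "('a::complex_hilbert_space \<Rightarrow> 'a) \<Rightarrow> bool" where
  "orthogonal_projection P \<longleftrightarrow> self_adjoint P \<and> P \<circ> P = P"

definition projection_valued_measure ::
  "(real set \<Rightarrow> 'a::complex_hilbert_space \<Rightarrow> 'a) \<Rightarrow> bool" where
  "projection_valued_measure E \<longleftrightarrow>
     (\<forall>\<Omega>\<in>sets borel. orthogonal_projection (E \<Omega>)) \<and>
     E UNIV = id \<and>
     (\<forall>\<Omega> :: nat \<Rightarrow> real set. range \<Omega> \<subseteq> sets borel \<longrightarrow> disjoint_family \<Omega> \<longrightarrow>
        (\<forall>x. (\<lambda>n. E (\<Omega> n) x) sums E (\<Union>n. \<Omega> n) x))"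

text \<open>The scalar measure \<open>\<Omega> \<mapsto> \<langle>E(\<Omega>)x, x\<rangle> = \<parallel>E(\<Omega>)x\<parallel>\<^sup>2\<close>.\<close>

definition scalar_measure ::
  "(real set \<Rightarrow> 'a::complex_hilbert_space \<Rightarrow> 'a) \<Rightarrow> 'a \<Rightarrow> real measure" where
  "scalar_measure E x =
     measure_of UNIV (sets borel) (\<lambda>\<Omega>. ennreal (Re (cinner (E \<Omega> x) x)))"

text \<open>
  \<open>X = \<integral> t dE(t)\<close> in the weak sense. By polarization it suffices to
  require this on the diagonal.
\<close>

definition is_spectral_measure ::
  "(real set \<Rightarrow> 'a::complex_hilbert_space \<Rightarrow> 'a) \<Rightarrow> ('a \<Rightarrow> 'a) \<Rightarrow> bool" where
  "is_spectral_measure E X \<longleftrightarrow>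
     projection_valued_measure E \<and>
     (\<forall>x. integrable (scalar_measure E x) (\<lambda>t. t) \<and>
          cinner (X x) x = complex_of_real (\<integral>t. t \<partial>scalar_measure E x))"

text \<open>
  \<open>E\<^bsub>\<Omega>\<^esub>(X)\<close>. For a bounded self-adjoint \<open>X\<close> the spectral theorem gives a spectral
  measure, unique on Borel sets, so for Borel \<open>\<Omega>\<close> the choice is immaterial.
\<close>

definition spectral_projection ::
  "real set \<Rightarrow> ('a::complex_hilbert_space \<Rightarrow> 'a) \<Rightarrow> 'a \<Rightarrow> 'a" where
  "spectral_projection \<Omega> X = (SOME E. is_spectral_measure E X) \<Omega>"

end

theory Submission
  imports Defs "HOL-Probability.Probability" "HOL-Real_Asymp.Real_Asymp"
begin

text \<open>
  If \<open>P' x - P x = x\<close> for orthogonal projections \<open>P'\<close> and \<open>P\<close>, then \<open>P' x = x\<close> and \<open>P x = 0\<close>.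
  For the spectral projections of \<open>T + S\<close> and \<open>T\<close> of the half-line \<open>(-\<infinity>, l)\<close> this means
  \<open>\<langle>(T + S)x, x\<rangle> < l\<parallel>x\<parallel>\<^sup>2 \<le> \<langle>Tx, x\<rangle>\<close> unless \<open>x = 0\<close>. Hence \<open>S\<close> is injective on \<open>Ker (D - I)\<close>,
  whose dimension is therefore at most the rank of \<open>S\<close>; the case of \<open>Ker (D + I)\<close> is symmetric.

  Since a spectral projection is a choice that means nothing unless a spectral measure exists,
  the spectral theorem is needed as well. After an affine change \<open>0 \<le> A \<le> I\<close>; then
  \<open>\<langle>A\<^sup>k (I - A)\<^sup>l x, x\<rangle> \<ge> 0\<close>, so by Hausdorff's moment theorem \<open>\<langle>p(A)x, x\<rangle> = \<integral>p d\<mu>\<^sub>x\<close>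
  for a measure \<open>\<mu>\<^sub>x\<close> on \<open>[0, 1]\<close>. Thus \<open>p \<mapsto> p(A)x\<close> is an isometry from polynomials in
  \<open>L\<^sup>2(\<mu>\<^sub>x)\<close> into the space, and \<open>E(\<Omega>)x\<close> is the limit of \<open>p\<^sub>n(A)x\<close> when \<open>p\<^sub>n\<close> tends to the
  indicator of \<open>\<Omega>\<close>.
\<close>

subsection \<open>Inner products\<close>

lemma cinner_add_right: "cinner x (y + z) = cinner x y + cinner x z"
  for x :: "'a::complex_hilbert_space"
  by (metis cinner_add_left cinner_commute complex_cnj_add)

lemma cinner_scaleC_right: "cinner x (a *\<^sub>C y) = cnj a * cinner x y"
  for x :: "'a::complex_hilbert_space"
  by (metis cinner_scaleC_left cinner_commute complex_cnj_mult)

lemma cinner_scaleR_left: "cinner (r *\<^sub>R x) y = of_real r * cinner x y"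
  for x :: "'a::complex_hilbert_space"
  by (metis cinner_scaleC_left scaleC_of_real)

lemma cinner_scaleR_right: "cinner x (r *\<^sub>R y) = of_real r * cinner x y"
  for x :: "'a::complex_hilbert_space"
  by (metis cinner_scaleC_right scaleC_of_real complex_cnj_complex_of_real)

lemma cinner_zero [simp]:
  fixes x :: "'a::complex_hilbert_space"
  shows "cinner 0 x = 0" "cinner x 0 = 0"
  using cinner_scaleR_left[of 0 0 x] cinner_scaleR_right[of x 0 0] by simp_all

lemma cinner_minus:
  fixes x :: "'a::complex_hilbert_space"
  shows "cinner (- x) y = - cinner x y" "cinner x (- y) = - cinner x y"
  using cinner_scaleR_left[of "-1" x y] cinner_scaleR_right[of x "-1" y] by simp_all

lemma cinner_diff:
  fixes x :: "'a::complex_hilbert_space"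
  shows "cinner (x - y) z = cinner x z - cinner y z" "cinner x (y - z) = cinner x y - cinner x z"
  using cinner_add_left[of x "- y" z] cinner_add_right[of x y "- z"] by (simp_all add: cinner_minus)

lemma cinner_sum_left: "cinner (\<Sum>i\<in>I. f i) y = (\<Sum>i\<in>I. cinner (f i) y)"
  for y :: "'a::complex_hilbert_space"
  by (induction I rule: infinite_finite_induct) (simp_all add: cinner_add_left)

lemmas cinner_simps = cinner_add_left cinner_add_right cinner_scaleC_left cinner_scaleC_right
  cinner_scaleR_left cinner_scaleR_right cinner_minus cinner_diff

lemma Re_cinner_commute: "Re (cinner x y) = Re (cinner y x)"
  for x :: "'a::complex_hilbert_space"
  by (subst cinner_commute) simp

lemma Re_cinner_self: "Re (cinner x x) = (norm x)\<^sup>2"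
  for x :: "'a::complex_hilbert_space"
  by (simp add: cinner_self)

lemma norm_add_sq: "(norm (x + y))\<^sup>2 = (norm x)\<^sup>2 + 2 * Re (cinner x y) + (norm y)\<^sup>2"
  for x :: "'a::complex_hilbert_space"
  using Re_cinner_commute[of x y] by (simp add: cinner_simps flip: Re_cinner_self)

lemma norm_diff_sq: "(norm (x - y))\<^sup>2 = (norm x)\<^sup>2 - 2 * Re (cinner x y) + (norm y)\<^sup>2"
  for x :: "'a::complex_hilbert_space"
  using norm_add_sq[of x "- y"] by (simp add: cinner_minus)

lemma Im_cinner: "Im (cinner x y) = Re (cinner x (\<i> *\<^sub>C y))"
  for x :: "'a::complex_hilbert_space"
  by (simp add: cinner_scaleC_right)

lemma norm_scaleC: "norm (a *\<^sub>C x) = cmod a * norm x"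
  for x :: "'a::complex_hilbert_space"
proof -
  have "complex_of_real ((norm (a *\<^sub>C x))\<^sup>2) = a * cnj a * complex_of_real ((norm x)\<^sup>2)"
    unfolding cinner_self[symmetric] by (simp add: cinner_scaleC_left cinner_scaleC_right)
  also have "\<dots> = complex_of_real ((cmod a * norm x)\<^sup>2)"
    by (simp add: power_mult_distrib flip: complex_norm_square)
  finally show ?thesis
    by (metis of_real_eq_iff norm_ge_zero mult_nonneg_nonneg power2_eq_imp_eq)
qed

text \<open>The triangle inequality belongs to the normed space structure, so expanding the squares
  of \<open>norm (x + y)\<close> and \<open>norm (x - y)\<close> turns it into the real
  Cauchy-Schwarz inequality.\<close>

lemma abs_Re_cinner_le: "\<bar>Re (cinner x y)\<bar> \<le> norm x * norm y"
  for x :: "'a::complex_hilbert_space"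
proof -
  have "(norm (x + y))\<^sup>2 \<le> (norm x + norm y)\<^sup>2" "(norm (x - y))\<^sup>2 \<le> (norm x + norm y)\<^sup>2"
    by (simp_all add: power_mono norm_triangle_ineq norm_triangle_ineq4)
  then show ?thesis
    by (simp add: norm_add_sq norm_diff_sq power2_sum abs_le_iff)
qed

lemma cmod_cinner_le: "cmod (cinner x y) \<le> norm x * norm y"
  for x :: "'a::complex_hilbert_space"
proof -
  \<comment> \<open>A phase that turns the inner product into its modulus and so reduces the complex
    inequality to the real one. It is 0 when the inner product vanishes, which is why
    \<open>norm (u *\<^sub>C x)\<close> is only bounded by \<open>norm x\<close> below.\<close>
  define u where "u = cnj (sgn (cinner x y))"
  have "cinner (u *\<^sub>C x) y = complex_of_real (cmod (cinner x y))"
    unfolding u_def cinner_scaleC_left sgn_div_norm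
    by (simp add: scaleR_conv_of_real complex_norm_square[symmetric] mult.commute power2_eq_square field_simps)
  then have "cmod (cinner x y) \<le> norm (u *\<^sub>C x) * norm y"
    using abs_Re_cinner_le[of "u *\<^sub>C x" y] by simp
  also have "norm (u *\<^sub>C x) \<le> norm x"
    by (simp add: norm_scaleC u_def norm_sgn)
  finally show ?thesis by (simp add: mult_right_mono)
qed

lemma tendsto_Re_cinner:
  fixes f :: "'b \<Rightarrow> 'a::complex_hilbert_space"
  assumes "(f \<longlongrightarrow> x) F"
  shows "((\<lambda>n. Re (cinner (f n) y)) \<longlongrightarrow> Re (cinner x y)) F"
proof -
  \<comment> \<open>Polarization writes the real part through norms, which are continuous.\<close>
  have *: "Re (cinner z y) = ((norm (z + y))\<^sup>2 - (norm z)\<^sup>2 - (norm y)\<^sup>2) / 2" for z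
    by (simp add: norm_add_sq)
  show ?thesis unfolding * by (intro tendsto_intros assms) simp
qed

lemma tendsto_cinner:
  fixes f :: "'b \<Rightarrow> 'a::complex_hilbert_space"
  assumes "(f \<longlongrightarrow> x) F"
  shows "((\<lambda>n. cinner (f n) y) \<longlongrightarrow> cinner x y) F"
  unfolding tendsto_complex_iff Im_cinner using assms by (auto intro: tendsto_Re_cinner)

subsection \<open>Self-adjoint operators\<close>

lemma linear_scaleC_iff:
  "Vector_Spaces.linear scaleC scaleC A \<longleftrightarrow>
    (\<forall>x y. A (x + y) = A x + A y) \<and> (\<forall>c x. A (c *\<^sub>C x) = c *\<^sub>C A x)"
  for A :: "'a::complex_hilbert_space \<Rightarrow> 'b::complex_hilbert_space"
  unfolding Vector_Spaces.linear_iff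
  by (auto simp: cplx.vector_space_axioms)

lemma self_adjoint_simps:
  fixes A :: "'a::complex_hilbert_space \<Rightarrow> 'a"
  assumes "self_adjoint A"
  shows self_adjoint_add: "A (x + y) = A x + A y"
    and self_adjoint_scaleC: "A (c *\<^sub>C x) = c *\<^sub>C A x"
    and self_adjoint_scaleR: "A (r *\<^sub>R x) = r *\<^sub>R A x"
    and self_adjoint_zero: "A 0 = 0"
    and self_adjoint_cinner: "cinner (A x) y = cinner x (A y)"
proof -
  show *: "A (x + y) = A x + A y" "A (c *\<^sub>C x) = c *\<^sub>C A x" "cinner (A x) y = cinner x (A y)"
    for x y c
    using assms unfolding self_adjoint_def linear_scaleC_iff by blast+
  show "A (r *\<^sub>R x) = r *\<^sub>R A x" for r x
    by (metis *(2) scaleC_of_real)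
  from this[of 0 0] show "A 0 = 0" by simp
qed

lemma self_adjoint_diff: "A (x - y) = A x - A y"
  if "self_adjoint A" for A :: "'a::complex_hilbert_space \<Rightarrow> 'a"
  using self_adjoint_add[OF that, of "x - y" y] by (simp add: algebra_simps)

lemma self_adjointI:
  fixes A :: "'a::complex_hilbert_space \<Rightarrow> 'a"
  assumes "\<And>x y. A (x + y) = A x + A y" "\<And>c x. A (c *\<^sub>C x) = c *\<^sub>C A x"
    "\<And>x y. cinner (A x) y = cinner x (A y)"
  shows "self_adjoint A"
  using assms unfolding self_adjoint_def linear_scaleC_iff by blast

lemma self_adjoint_cinner_real: "cinner (A x) x = complex_of_real (Re (cinner (A x) x))"
  if "self_adjoint A" for A :: "'a::complex_hilbert_space \<Rightarrow> 'a"
proof -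
  have "cinner (A x) x = cnj (cinner (A x) x)"
    by (metis cinner_commute self_adjoint_cinner[OF that])
  then show ?thesis
    by (metis Reals_cnj_iff of_real_Re)
qed

text \<open>The hypothesis says that \<open>G\<close>, the square of \<open>P\<close> minus
  \<open>P\<close>, has a vanishing quadratic form. As \<open>G\<close> is symmetric, polarization
  makes \<open>Re (cinner (G x) y)\<close> vanish for all \<open>y\<close>, and
  \<open>y = G x\<close> gives \<open>G x = 0\<close>.\<close>

lemma orthogonal_projectionI:
  fixes P :: "'a::complex_hilbert_space \<Rightarrow> 'a"
  assumes P: "self_adjoint P" and diag: "\<And>x. (norm (P x))\<^sup>2 = Re (cinner (P x) x)"
  shows "orthogonal_projection P"
proof -
  have "P (P x) = P x" for x
  proof -
    define G where "G x = P (P x) - P x" for x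
    have G_add: "G (x + y) = G x + G y" for x y
      by (simp add: G_def self_adjoint_add[OF P] algebra_simps)
    have G0: "Re (cinner (G x) x) = 0" for x
      unfolding G_def cinner_diff self_adjoint_cinner[OF P, of "P x"]
      by (simp add: Re_cinner_self diag)
    have "Re (cinner (G x) y) = Re (cinner (G y) x)" for x y
      unfolding G_def cinner_diff
      by (metis (no_types, lifting) P self_adjoint_cinner Re_cinner_commute minus_complex.sel(1))
    then have "2 * Re (cinner (G x) y) = Re (cinner (G (x + y)) (x + y))" for x y
      using G0[of x] G0[of y] unfolding G_add by (simp add: cinner_simps)
    from this[of x "G x"] G0 have "G x = 0" by (simp add: Re_cinner_self)
    then show ?thesis by (simp add: G_def)
  qed
  with P show ?thesis by (auto simp: orthogonal_projection_def)
qed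

lemma orthogonal_projection_cinner: "Re (cinner (P x) x) = (norm (P x))\<^sup>2"
  if "orthogonal_projection P" for P :: "'a::complex_hilbert_space \<Rightarrow> 'a"
proof -
  have "self_adjoint P" "P (P x) = P x"
    using that by (auto simp: orthogonal_projection_def fun_eq_iff)
  then have "cinner (P x) x = cinner (P x) (P x)" by (simp add: self_adjoint_cinner)
  then show ?thesis by (simp add: Re_cinner_self)
qed

subsection \<open>Polynomials of an operator\<close>

text \<open>Horner's scheme. Real coefficients keep the resulting operator self-adjoint.\<close>

definition poly_op :: "('a::complex_hilbert_space \<Rightarrow> 'a) \<Rightarrow> real poly \<Rightarrow> 'a \<Rightarrow> 'a" where
  "poly_op A p = fold_coeffs (\<lambda>a f x. a *\<^sub>R x + A (f x)) p (\<lambda>x. 0)"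

locale self_adjoint_op =
  fixes A :: "'a::complex_hilbert_space \<Rightarrow> 'a"
  assumes sa: "self_adjoint A"
begin

lemmas A_simps = self_adjoint_add[OF sa] self_adjoint_diff[OF sa] self_adjoint_scaleC[OF sa]
  self_adjoint_scaleR[OF sa] self_adjoint_zero[OF sa]

lemma poly_op_0 [simp]: "poly_op A 0 x = 0"
  by (simp add: poly_op_def)

lemma poly_op_pCons [simp]: "poly_op A (pCons a p) x = a *\<^sub>R x + A (poly_op A p x)"
  by (cases "p = 0 \<and> a = 0") (auto simp add: poly_op_def A_simps)

lemma poly_op_add: "poly_op A (p + q) x = poly_op A p x + poly_op A q x"
  by (induction p q rule: poly_induct2) (simp_all add: A_simps algebra_simps)

lemma poly_op_smult: "poly_op A (smult c p) x = c *\<^sub>R poly_op A p x"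
  by (induction p) (simp_all add: A_simps algebra_simps)

lemma poly_op_diff: "poly_op A (p - q) x = poly_op A p x - poly_op A q x"
  using poly_op_add[of p "smult (-1) q"] poly_op_smult[of "-1" q] by simp

lemma poly_op_mult: "poly_op A (p * q) x = poly_op A p (poly_op A q x)"
  by (induction p) (simp_all add: A_simps poly_op_add poly_op_smult)

lemma poly_op_one [simp]: "poly_op A 1 x = x"
  by (simp add: one_pCons A_simps)

lemma self_adjoint_poly_op: "self_adjoint (poly_op A p)"
proof (induction p)
  case 0
  show ?case by (intro self_adjointI) simp_all
next
  case (pCons a p)
  \<comment> \<open>The polynomial \<open>[:0, 1:]\<close> commutes with \<open>p\<close>;
    \<open>poly_op_mult\<close> carries this over to operators.\<close>
  have comm: "A (poly_op A p x) = poly_op A p (A x)" for x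
    using poly_op_mult[of "[:0, 1:]" p x] poly_op_mult[of p "[:0, 1:]" x]
    by (simp add: A_simps mult.commute)
  show ?case
  proof (intro self_adjointI)
    show "poly_op A (pCons a p) (c *\<^sub>C x) = c *\<^sub>C poly_op A (pCons a p) x" for c x
      by (simp add: self_adjoint_simps[OF pCons.IH] A_simps scaleC_add_right scaleC_scaleC
          mult.commute flip: scaleC_of_real)
    show "cinner (poly_op A (pCons a p) x) y = cinner x (poly_op A (pCons a p) y)" for x y
      using self_adjoint_cinner[OF sa, of "poly_op A p x" y]
        self_adjoint_cinner[OF pCons.IH, of x "A y"]
      by (simp add: cinner_simps comm)
  qed (simp add: self_adjoint_simps[OF pCons.IH] A_simps algebra_simps)
qed

text \<open>For fixed \<open>x\<close> this is the linear functional on polynomials for which a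
  representing measure on [0, 1] is constructed below.\<close>

definition pform :: "'a \<Rightarrow> real poly \<Rightarrow> real" where
  "pform x p = Re (cinner (poly_op A p x) x)"

lemma pform_add: "pform x (p + q) = pform x p + pform x q"
  by (simp add: pform_def poly_op_add cinner_simps)

lemma pform_smult: "pform x (smult c p) = c * pform x p"
  by (simp add: pform_def poly_op_smult cinner_simps)

lemma pform_one: "pform x 1 = (norm x)\<^sup>2"
  by (simp add: pform_def Re_cinner_self)

text \<open>One factor \<open>poly_op A q\<close> moves across the inner product by symmetry. Thus
  nonnegativity of the form of \<open>p\<close> at all vectors passes to
  \<open>q * p * q\<close>.\<close>

lemma pform_sandwich: "pform x (q * p * q) = pform (poly_op A q x) p"
  using self_adjoint_cinner[OF self_adjoint_poly_op, of q "poly_op A (p * q) x" x]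
  by (simp add: pform_def mult.assoc poly_op_mult)

lemma norm_poly_op_sq: "(norm (poly_op A p x))\<^sup>2 = pform x (p\<^sup>2)"
  using pform_sandwich[of x p 1] by (simp add: pform_one power2_eq_square)

end

subsection \<open>The Hausdorff moment problem\<close>

text \<open>For \<open>j \<le> k\<close> the ratio is the product of the factors
  \<open>(k - i) / (n - i)\<close> with \<open>i < j\<close>. Each lies in [0, 1] and within
  \<open>J / (n - J)\<close> of \<open>k / n\<close>, and replacing them one at a time adds up at
  most \<open>j\<close> such errors. \<open>J\<close> stays fixed so that all steps of the induction
  share one bound.\<close>

lemma binomial_ratio_bound:
  fixes n J j k :: nat
  assumes "J < n" "k \<le> n" "j \<le> J"
  shows "\<bar>real (k choose j) / real (n choose j) - (real k / real n) ^ j\<bar>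
    \<le> real j * (real J / real (n - J))"
  using assms(3)
proof (induction j)
  case (Suc j)
  define D where "D = real J / real (n - J)"
  define c where "c = real k / real n"
  define g where "g = real (k choose j) / real (n choose j)"
  have c: "0 \<le> c" "c \<le> 1" using assms by (auto simp: c_def)
  have D: "0 \<le> D" by (simp add: D_def)
  have jn: "j < n" using Suc assms by simp
  have IH: "\<bar>g - c ^ j\<bar> \<le> real j * D" using Suc by (simp add: g_def c_def D_def)
  have step: "(m choose Suc j) * Suc j = (m choose j) * (m - j)" for m
    using binomial_absorption[of j m] binomial_absorb_comp[of m j] by (simp add: mult.commute)
  have eq: "real (m choose Suc j) = real (m choose j) * real (m - j) / real (Suc j)" for m
    using arg_cong[OF step[of m], of real] unfolding of_nat_mult by (simp add: field_simps del: binomial_Suc_Suc)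
  have gS: "real (k choose Suc j) / real (n choose Suc j) = g * (real (k - j) / real (n - j))"
    using jn by (simp add: eq g_def field_simps del: binomial_Suc_Suc of_nat_Suc)
  have "\<bar>g * (real (k - j) / real (n - j)) - c ^ Suc j\<bar> \<le> real (Suc j) * D"
  \<comment> \<open>For \<open>k < j\<close> truncated subtraction would spoil the formula for
    \<open>c - r\<close>; there \<open>g = 0\<close>, and the induction hypothesis already bounds
    \<open>c ^ j\<close>.\<close>
  proof (cases "k < j")
    case True
    then have "g = 0" by (simp add: g_def)
    with IH c have "c ^ j \<le> real j * D" "c * c ^ j \<le> c ^ j" by (auto intro: mult_left_le_one_le)
    with \<open>g = 0\<close> c D show ?thesis by (simp add: algebra_simps)
  next
    case False
    define r where "r = real (k - j) / real (n - j)"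
    have r: "0 \<le> r" "r \<le> 1" using False assms jn by (auto simp: r_def)
    have "c - r = (real j / real (n - j)) * (real (n - k) / real n)"
      using False jn assms by (simp add: c_def r_def of_nat_diff field_simps)
    then have "\<bar>r - c\<bar> = (real j / real (n - j)) * (real (n - k) / real n)"
      by (simp add: abs_minus_commute)
    also have "\<dots> \<le> (real j / real (n - j)) * 1"
      using jn by (intro mult_left_mono) auto
    also have "\<dots> \<le> D"
      unfolding D_def using Suc assms by (auto intro!: frac_le)
    finally have rc: "\<bar>r - c\<bar> \<le> D" .
    have "g * r - c ^ Suc j = (g - c ^ j) * r + c ^ j * (r - c)"
      by (simp add: algebra_simps)
    then have "\<bar>g * r - c ^ Suc j\<bar> \<le> \<bar>g - c ^ j\<bar> * r + c ^ j * \<bar>r - c\<bar>"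
      using r c by (metis abs_mult abs_of_nonneg abs_triangle_ineq zero_le_power)
    also have "\<dots> \<le> \<bar>g - c ^ j\<bar> * 1 + 1 * \<bar>r - c\<bar>"
      using r c by (intro add_mono mult_left_mono mult_right_mono) (auto simp: power_le_one)
    also have "\<dots> \<le> real (Suc j) * D" using IH rc by (simp add: algebra_simps)
    finally show ?thesis by (simp add: r_def)
  qed
  then show ?case unfolding gS c_def D_def .
qed simp

text \<open>Choosing first \<open>k\<close> of \<open>n\<close> and then \<open>j\<close> of
  \<open>k\<close> is choosing \<open>j\<close> of \<open>n\<close> and then \<open>k - j\<close> of
  the rest. The constant factor comes out and the binomial expansion of
  \<open>(x + y) ^ (n - j) = 1\<close> remains. The general ring admits the polynomials X and 1 - X
  as \<open>x\<close> and \<open>y\<close>.\<close>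

lemma binomial_moment_identity:
  fixes x y :: "'a::comm_ring_1"
  assumes "x + y = 1" "j \<le> n"
  shows "(\<Sum>k\<le>n. of_nat ((n choose k) * (k choose j)) * (x ^ k * y ^ (n - k))) = of_nat (n choose j) * x ^ j"
proof -
  have "(\<Sum>k\<le>n. of_nat ((n choose k) * (k choose j)) * (x ^ k * y ^ (n - k))) =
      (\<Sum>k\<in>{j..n}. of_nat ((n choose k) * (k choose j)) * (x ^ k * y ^ (n - k)))"
    by (rule sum.mono_neutral_right) (auto simp: not_le binomial_eq_0)
  also have "\<dots> = (\<Sum>i\<le>n - j. of_nat ((n choose (i + j)) * (i + j choose j)) * (x ^ (i + j) * y ^ (n - (i + j))))"
    by (rule sum.reindex_bij_witness[of _ "\<lambda>i. i + j" "\<lambda>k. k - j"]) (use assms in auto)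
  also have "\<dots> = (\<Sum>i\<le>n - j. of_nat (n choose j) * x ^ j * (of_nat (n - j choose i) * x ^ i * y ^ (n - j - i)))"
  proof (rule sum.cong[OF refl])
    fix i assume "i \<in> {..n - j}"
    then have "(n choose (i + j)) * (i + j choose j) = (n choose j) * (n - j choose i)"
      using choose_mult[of j "i + j" n] assms by simp
    then show "of_nat ((n choose (i + j)) * (i + j choose j)) * (x ^ (i + j) * y ^ (n - (i + j))) =
        of_nat (n choose j) * x ^ j * (of_nat (n - j choose i) * x ^ i * y ^ (n - j - i))"
      by (simp add: power_add mult_ac diff_diff_add add.commute)
  qed
  also have "\<dots> = of_nat (n choose j) * x ^ j * (x + y) ^ (n - j)"
    by (simp add: binomial_ring sum_distrib_left)
  finally show ?thesis by (simp add: assms)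
qed

text \<open>The points \<open>a k\<close> may coincide, so the measure is built as the image of a
  distribution on the indices. The last property will serve tightness.\<close>

lemma distr_finite_support_pmf:
  fixes w :: "nat \<Rightarrow> real" and a :: "nat \<Rightarrow> real"
  assumes "\<And>k. 0 \<le> w k" "\<And>k. n < k \<Longrightarrow> w k = 0" "(\<Sum>k\<le>n. w k) = 1"
  obtains M where "real_distribution M" "\<And>f :: real \<Rightarrow> real. f \<in> borel_measurable borel \<Longrightarrow>
    (\<integral>t. f t \<partial>M) = (\<Sum>k\<le>n. w k * f (a k))"
    "\<And>\<Omega>. \<Omega> \<in> sets borel \<Longrightarrow> (\<And>k. k \<le> n \<Longrightarrow> a k \<in> \<Omega>) \<Longrightarrow> measure M \<Omega> = 1"
proof
  define p where "p = embed_pmf w"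
  have nn: "(\<integral>\<^sup>+ k. ennreal (w k) \<partial>count_space UNIV) = 1"
    using assms by (subst nn_integral_count_space'[of "{..n}"]) (auto simp: not_le)
  have pmf: "pmf p k = w k" for k
    unfolding p_def by (rule pmf_embed_pmf[OF assms(1) nn])
  define M where "M = distr (measure_pmf p) borel a"
  show M: "real_distribution M"
    unfolding M_def by (rule prob_space.real_distribution_distr[OF prob_space_measure_pmf]) simp
  show *: "(\<integral>t. f t \<partial>M) = (\<Sum>k\<le>n. w k * f (a k))"
    if [measurable]: "f \<in> borel_measurable borel" for f :: "real \<Rightarrow> real"
  proof -
    have "(\<integral>t. f t \<partial>M) = (\<integral>k. f (a k) \<partial>measure_pmf p)"
      unfolding M_def by (subst integral_distr) auto
    also have "\<dots> = (\<Sum>k\<le>n. f (a k) * pmf p k)"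
      by (rule integral_measure_pmf_real) (use assms(2) in \<open>auto simp: set_pmf_iff pmf not_le[symmetric]\<close>)
    finally show ?thesis by (simp add: pmf mult.commute)
  qed
  show "measure M \<Omega> = 1" if "\<Omega> \<in> sets borel" "\<And>k. k \<le> n \<Longrightarrow> a k \<in> \<Omega>" for \<Omega>
  proof -
    interpret real_distribution M by fact
    have "measure M \<Omega> = (\<integral>t. indicator \<Omega> t \<partial>M)" using that by simp
    also have "\<dots> = (\<Sum>k\<le>n. w k * indicator \<Omega> (a k))" using that by (intro *) simp
    also have "\<dots> = 1" using that assms(3) by simp
    finally show ?thesis .
  qed
qed

text \<open>For each \<open>n\<close>, \<open>L\<close> induces a discrete probability measure on
  the points \<open>k / n\<close>, and its moments tend to those prescribed by \<open>L\<close>. All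
  these measures live on one bounded interval, so a subsequence converges weakly, and the limit
  represents \<open>L\<close>.\<close>

theorem Hausdorff_moment:
  fixes L :: "real poly \<Rightarrow> real"
  assumes add: "\<And>p q. L (p + q) = L p + L q" and smult: "\<And>c p. L (smult c p) = c * L p"
    and nonneg: "\<And>k l. 0 \<le> L ([:0, 1:] ^ k * [:1, - 1:] ^ l)" and one: "L 1 = 1"
  obtains M where "real_distribution M" "AE t in M. t \<in> {0..1}" "\<And>p. L p = (\<integral>t. poly p t \<partial>M)"
proof -
  let ?X = "[:0, 1:] :: real poly" and ?Y = "[:1, - 1:] :: real poly"
  have L_sum: "L (\<Sum>i\<in>I. p i) = (\<Sum>i\<in>I. L (p i))" for p and I :: "nat set"
    using smult[of 0 0] by (induction I rule: infinite_finite_induct) (simp_all add: add)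
  \<comment> \<open>The values of \<open>L\<close> at the Bernstein polynomials, which are
    nonnegative by hypothesis and sum to \<open>L 1\<close>.\<close>
  define w where "w n k = real (n choose k) * L (?X ^ k * ?Y ^ (n - k))" for n k
  \<comment> \<open>With \<open>k choose j\<close> in place of a power of \<open>k\<close> the
    moment identity is exact for every \<open>n\<close>; \<open>binomial_ratio_bound\<close> later
    pays for the exchange.\<close>
  have w_moment: "(\<Sum>k\<le>n. w n k * (real (k choose j) / real (n choose j))) = L (?X ^ j)" if "j \<le> n" for n j
  proof -
    have "(\<Sum>k\<le>n. w n k * real (k choose j)) = L (\<Sum>k\<le>n. of_nat ((n choose k) * (k choose j)) * (?X ^ k * ?Y ^ (n - k)))"
      unfolding w_def L_sum by (simp add: of_nat_poly smult mult_ac)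
    also have "\<dots> = real (n choose j) * L (?X ^ j)"
      using that by (subst binomial_moment_identity) (simp_all add: one_pCons of_nat_poly smult)
    finally show ?thesis using that
      by (simp add: sum_divide_distrib[symmetric] field_simps)
  qed
  have w_nonneg: "0 \<le> w n k" for n k by (simp add: w_def nonneg)
  have w_sum: "(\<Sum>k\<le>n. w n k) = 1" for n
    using w_moment[of 0 n] by (simp add: one)
  define R where "R n \<mu> \<longleftrightarrow> real_distribution \<mu> \<and> (\<forall>f :: real \<Rightarrow> real. f \<in> borel_measurable borel \<longrightarrow>
      (\<integral>t. f t \<partial>\<mu>) = (\<Sum>k\<le>n. w n k * f (real k / real n))) \<and> measure \<mu> {-1<..1} = 1" for n \<mu>
  have "\<forall>n. \<exists>\<mu>. R n \<mu>"
  proof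
    fix n
    obtain \<mu> where "real_distribution \<mu>" "\<And>f :: real \<Rightarrow> real. f \<in> borel_measurable borel \<Longrightarrow>
      (\<integral>t. f t \<partial>\<mu>) = (\<Sum>k\<le>n. w n k * f (real k / real n))"
      "\<And>\<Omega>. \<Omega> \<in> sets borel \<Longrightarrow> (\<And>k. k \<le> n \<Longrightarrow> real k / real n \<in> \<Omega>) \<Longrightarrow> measure \<mu> \<Omega> = 1"
      by (rule distr_finite_support_pmf[of "w n" n "\<lambda>k. real k / real n"])
        (auto simp: w_nonneg w_sum, auto simp: w_def binomial_eq_0)
    \<comment> \<open>Tightness is phrased with intervals open on the left, so the left end has to
      lie below 0. For \<open>n = 0\<close> the only point is \<open>0 / 0 = 0\<close>.\<close>
    moreover have "-1 < real k / real n" "real k / real n \<le> 1" if "k \<le> n" for k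
      using that by (auto simp: divide_le_eq less_le_trans[of "-1" 0])
    ultimately show "\<exists>\<mu>. R n \<mu>" unfolding R_def by (intro exI[of _ \<mu>]) auto
  qed
  then obtain \<mu> where "\<And>n. R n (\<mu> n)"
    using choice[of R] by blast
  then have \<mu>: "\<And>n. real_distribution (\<mu> n)" "\<And>n. measure (\<mu> n) {-1<..1} = 1"
    and \<mu>_int: "\<And>n f. f \<in> borel_measurable borel \<Longrightarrow>
      (\<integral>t. f t \<partial>\<mu> n) = (\<Sum>k\<le>n. w n k * f (real k / real n))"
    by (auto simp: R_def)
  have "tight \<mu>"
    unfolding tight_def
  proof (intro conjI allI impI)
    show "\<exists>a b::real. a < b \<and> (\<forall>n. 1 - e < measure (\<mu> n) {a<..b})" if "0 < e" for e
      by (rule exI[of _ "-1"], rule exI[of _ 1]) (simp add: \<mu> that)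
  qed (rule \<mu>)
  then obtain r M where r: "strict_mono (r :: nat \<Rightarrow> nat)" and M: "real_distribution M"
    and weak: "weak_conv_m (\<mu> \<circ> r) M"
    using tight_imp_convergent_subsubsequence[of \<mu> id] by (auto simp: strict_mono_def)
  interpret real_distribution M by fact
  have conv: "(\<lambda>n. \<Sum>k\<le>r n. w (r n) k * f (real k / real (r n))) \<longlonglongrightarrow> (\<integral>t. f t \<partial>M)"
    if "continuous_on UNIV f" "\<And>t. \<bar>f t\<bar> \<le> B" for f :: "real \<Rightarrow> real" and B
  proof -
    have "(\<lambda>n. \<integral>t. f t \<partial>(\<mu> \<circ> r) n) \<longlonglongrightarrow> (\<integral>t. f t \<partial>M)"
      using \<mu>(1) M weak that
      by (intro weak_conv_imp_integral_bdd_continuous_conv[of _ _ _ B])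
         (auto simp: continuous_on_eq_continuous_at o_def)
    then show ?thesis
      using that by (simp add: \<mu>_int borel_measurable_continuous_onI)
  qed
  have frac: "0 \<le> real k / real n" "real k / real n \<le> 1" if "k \<le> n" for k n
    using that by (auto simp: divide_le_eq)
  \<comment> \<open>A bounded continuous function vanishing exactly on [0, 1]: it integrates to 0
    against every discrete measure, hence against the weak limit.\<close>
  define d where "d t = min 1 (max 0 (- t) + max 0 (t - 1))" for t :: real
  have d_cont: "continuous_on UNIV d" unfolding d_def by (intro continuous_intros)
  then have [measurable]: "d \<in> borel_measurable borel" by (rule borel_measurable_continuous_onI)
  have d: "\<And>t. 0 \<le> d t" "\<And>t. \<bar>d t\<bar> \<le> 1" "\<And>t. d t = 0 \<longleftrightarrow> t \<in> {0..1}"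
    unfolding d_def by (auto simp: max_def min_def)
  have AE01: "AE t in M. t \<in> {0..1}"
  proof -
    have "(\<Sum>k\<le>r n. w (r n) k * d (real k / real (r n))) = 0" for n
      using frac[of _ "r n"] d(3) by (intro sum.neutral) auto
    then have "(\<integral>t. d t \<partial>M) = 0"
      using conv[OF d_cont d(2)] by (simp add: LIMSEQ_const_iff)
    moreover have "integrable M d"
      using d(2) by (intro integrable_const_bound[of _ 1]) auto
    ultimately have "AE t in M. d t = 0"
      using integral_nonneg_eq_0_iff_AE[of M d] d(1) by simp
    then show ?thesis by (simp add: d(3))
  qed
  \<comment> \<open>Weak convergence tests only bounded continuous functions. Truncated powers are
    such functions and agree with the powers on [0, 1], which carries all the measures.\<close>
  define clamp where "clamp t = max 0 (min 1 t)" for t :: real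
  have clamp: "clamp t = t" if "t \<in> {0..1}" for t using that by (auto simp: clamp_def)
  have moment: "(\<integral>t. t ^ j \<partial>M) = L (?X ^ j)" for j
  proof (rule LIMSEQ_unique)
    have "(\<lambda>n. \<Sum>k\<le>r n. w (r n) k * clamp (real k / real (r n)) ^ j) \<longlonglongrightarrow> (\<integral>t. clamp t ^ j \<partial>M)"
    proof (rule conv[of _ 1])
      show "continuous_on UNIV (\<lambda>t. clamp t ^ j)" unfolding clamp_def by (intro continuous_intros)
      show "\<bar>clamp t ^ j\<bar> \<le> 1" for t by (auto simp: clamp_def power_abs intro!: power_le_one)
    qed
    also have "(\<lambda>n. \<Sum>k\<le>r n. w (r n) k * clamp (real k / real (r n)) ^ j) =
        (\<lambda>n. \<Sum>k\<le>r n. w (r n) k * (real k / real (r n)) ^ j)"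
      using frac by (auto intro!: sum.cong simp: clamp)
    also have "(\<integral>t. clamp t ^ j \<partial>M) = (\<integral>t. t ^ j \<partial>M)"
      by (rule integral_cong_AE) (use AE01 in \<open>auto simp: clamp_def\<close>)
    finally show "(\<lambda>n. \<Sum>k\<le>r n. w (r n) k * (real k / real (r n)) ^ j) \<longlonglongrightarrow> (\<integral>t. t ^ j \<partial>M)" .
    have "(\<lambda>n. \<Sum>k\<le>n. w n k * (real k / real n) ^ j) \<longlonglongrightarrow> L (?X ^ j)"
    proof (rule LIM_zero_cancel, rule Lim_null_comparison)
      show "(\<lambda>n. real j * (real j / real (n - j))) \<longlonglongrightarrow> 0"
        by real_asymp
      show "\<forall>\<^sub>F n in sequentially. norm ((\<Sum>k\<le>n. w n k * (real k / real n) ^ j) - L (?X ^ j))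
          \<le> real j * (real j / real (n - j))"
        using eventually_gt_at_top[of j]
      proof eventually_elim
        case (elim n)
        \<comment> \<open>The bound of \<open>binomial_ratio_bound\<close> for \<open>J = j\<close>.
          The weights sum to 1, so averaging does not enlarge it.\<close>
        let ?e = "real j * (real j / real (n - j))"
        have "(\<Sum>k\<le>n. w n k * (real k / real n) ^ j) - L (?X ^ j) =
            (\<Sum>k\<le>n. w n k * ((real k / real n) ^ j - real (k choose j) / real (n choose j)))"
          using w_moment[of j n] elim by (simp add: right_diff_distrib sum_subtractf)
        also have "norm \<dots> \<le> (\<Sum>k\<le>n. w n k * ?e)"
        proof (rule sum_norm_le)
          fix k assume "k \<in> {..n}"
          then have "\<bar>(real k / real n) ^ j - real (k choose j) / real (n choose j)\<bar> \<le> ?e"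
            using binomial_ratio_bound[of j n k j] elim by (simp only: abs_minus_commute atMost_iff)
          then show "norm (w n k * ((real k / real n) ^ j - real (k choose j) / real (n choose j))) \<le> w n k * ?e"
            unfolding real_norm_def abs_mult abs_of_nonneg[OF w_nonneg] by (rule mult_left_mono[OF _ w_nonneg])
        qed
        also have "\<dots> = ?e" unfolding sum_distrib_right[symmetric] w_sum by simp
        finally show ?case .
      qed
    qed
    from LIMSEQ_subseq_LIMSEQ[OF this r]
    show "(\<lambda>n. \<Sum>k\<le>r n. w (r n) k * (real k / real (r n)) ^ j) \<longlonglongrightarrow> L (?X ^ j)"
      by (simp add: o_def)
  qed
  have int: "integrable M (\<lambda>t. t ^ j)" for j
  proof (rule integrable_const_bound[of _ 1])
    show "AE t in M. norm (t ^ j) \<le> 1"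
      using AE01 by eventually_elim (auto simp: power_abs intro: power_le_one)
  qed simp
  have "L p = (\<integral>t. poly p t \<partial>M)" for p
  proof -
    have "(\<Sum>i\<le>degree p. smult (coeff p i) (?X ^ i)) = p"
      using poly_as_sum_of_monoms[of p] by (simp add: monom_altdef)
    from arg_cong[OF this, of L] have "L p = (\<Sum>i\<le>degree p. coeff p i * L (?X ^ i))"
      by (simp add: L_sum smult)
    also have "\<dots> = (\<integral>t. (\<Sum>i\<le>degree p. coeff p i * t ^ i) \<partial>M)"
      by (simp add: moment int)
    finally show ?thesis by (simp add: poly_altdef)
  qed
  with M AE01 show thesis by (rule that)
qed

subsection \<open>Density of polynomials\<close>

text \<open>Finite rather than probability measures: the measure representing a vector
  \<open>x\<close> will have mass \<open>(norm x)\<^sup>2\<close>, which is 0 for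
  \<open>x = 0\<close>.\<close>

definition unit_interval_measure :: "real measure \<Rightarrow> bool" where
  "unit_interval_measure M \<longleftrightarrow>
    finite_measure M \<and> sets M = sets borel \<and> (AE t in M. t \<in> {0..1})"

lemma unit_interval_integrable:
  assumes "unit_interval_measure M" and [measurable]: "f \<in> borel_measurable borel"
    and "\<And>t. t \<in> {0..1} \<Longrightarrow> \<bar>f t\<bar> \<le> B"
  shows "integrable M (f :: real \<Rightarrow> real)"
proof -
  interpret finite_measure M using assms by (simp add: unit_interval_measure_def)
  have [measurable_cong]: "sets M = sets borel" and AE: "AE t in M. t \<in> {0..1}"
    using assms by (simp_all add: unit_interval_measure_def)
  show ?thesis
  proof (rule integrable_const_bound[of _ B])
    show "AE t in M. norm (f t) \<le> B" using AE by eventually_elim (simp add: assms)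
  qed measurable
qed

lemma poly_bounded_on_unit_interval:
  obtains B where "\<And>t. t \<in> {0..1} \<Longrightarrow> \<bar>poly p t\<bar> \<le> (B::real)"
proof -
  have "compact (poly p ` {0..1::real})"
    by (intro compact_continuous_image continuous_intros) simp
  then obtain B where "\<forall>y\<in>poly p ` {0..1}. norm y \<le> B"
    using compact_imp_bounded bounded_iff by blast
  then show ?thesis by (intro that[of B]) auto
qed

lemma borel_measurable_poly [measurable]: "(\<lambda>t. poly p t) \<in> borel_measurable (borel :: real measure)"
  by (intro borel_measurable_continuous_onI continuous_intros)

lemma unit_interval_integrable_poly: "integrable M (\<lambda>t. poly p t)" if "unit_interval_measure M"
proof -
  obtain B where "\<And>t. t \<in> {0..1} \<Longrightarrow> \<bar>poly p t\<bar> \<le> B"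
    using poly_bounded_on_unit_interval by blast
  then show ?thesis by (intro unit_interval_integrable[OF that]) auto
qed

lemma unit_interval_integrable_sq:
  assumes "unit_interval_measure M" and [measurable]: "f \<in> borel_measurable borel"
    and "\<And>t. \<bar>f t\<bar> \<le> B"
  shows "integrable M (\<lambda>t. (poly p t - f t)\<^sup>2 :: real)"
proof -
  obtain C where C: "\<And>t. t \<in> {0..1} \<Longrightarrow> \<bar>poly p t\<bar> \<le> C"
    using poly_bounded_on_unit_interval by blast
  show ?thesis
  proof (rule unit_interval_integrable[OF assms(1), of _ "(C + B)\<^sup>2"])
    fix t :: real assume "t \<in> {0..1}"
    with C[of t] assms(3)[of t] have "\<bar>poly p t - f t\<bar> \<le> C + B" by linarith
    then show "\<bar>(poly p t - f t)\<^sup>2\<bar> \<le> (C + B)\<^sup>2"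
      using power_mono[of "\<bar>poly p t - f t\<bar>" "C + B" 2] by simp
  qed measurable
qed

text \<open>The triangle inequality for squared errors, at the price of the factor 2; this explains
  the tolerances \<open>e / 4\<close> below.\<close>

lemma integral_sq_add_le:
  fixes u v :: "'b \<Rightarrow> real"
  assumes "integrable M (\<lambda>t. (u t)\<^sup>2)" "integrable M (\<lambda>t. (v t)\<^sup>2)"
    and "integrable M (\<lambda>t. (u t + v t)\<^sup>2)"
  shows "(\<integral>t. (u t + v t)\<^sup>2 \<partial>M) \<le> 2 * (\<integral>t. (u t)\<^sup>2 \<partial>M) + 2 * (\<integral>t. (v t)\<^sup>2 \<partial>M)"
proof -
  have "(u t + v t)\<^sup>2 \<le> 2 * (u t)\<^sup>2 + 2 * (v t)\<^sup>2" for t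
    using zero_le_power2[of "u t - v t"] by (simp add: power2_eq_square algebra_simps)
  then have "(\<integral>t. (u t + v t)\<^sup>2 \<partial>M) \<le> (\<integral>t. 2 * (u t)\<^sup>2 + 2 * (v t)\<^sup>2 \<partial>M)"
    using assms by (intro integral_mono) auto
  also have "\<dots> = 2 * (\<integral>t. (u t)\<^sup>2 \<partial>M) + 2 * (\<integral>t. (v t)\<^sup>2 \<partial>M)"
    using assms by (subst Bochner_Integration.integral_add) auto
  finally show ?thesis .
qed

text \<open>
  Approximation is simultaneous for a finite family of measures, because linearity of the
  functional calculus compares three of them (those of \<open>x\<close>, \<open>y\<close> and \<open>x + y\<close>).
\<close>

locale unit_interval_measures =
  fixes I :: "'i set" and \<mu> :: "'i \<Rightarrow> real measure"
  assumes fin: "finite I" and \<mu>: "\<And>i. i \<in> I \<Longrightarrow> unit_interval_measure (\<mu> i)"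
begin

text \<open>A single polynomial has to serve all measures of the family. Boundedness makes the
  squared errors integrable.\<close>

definition poly_approximable :: "(real \<Rightarrow> real) \<Rightarrow> bool" where
  "poly_approximable f \<longleftrightarrow> f \<in> borel_measurable borel \<and> (\<exists>B. \<forall>t. \<bar>f t\<bar> \<le> B) \<and>
    (\<forall>e>0. \<exists>p. \<forall>i\<in>I. (\<integral>t. (poly p t - f t)\<^sup>2 \<partial>\<mu> i) < e)"

lemma poly_approximableD:
  "poly_approximable f \<Longrightarrow> 0 < e \<Longrightarrow> \<exists>p. \<forall>i\<in>I. (\<integral>t. (poly p t - f t)\<^sup>2 \<partial>\<mu> i) < e"
  unfolding poly_approximable_def by blast

lemma poly_approximableI:
  "f \<in> borel_measurable borel \<Longrightarrow> (\<And>t. \<bar>f t\<bar> \<le> B) \<Longrightarrow>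
    (\<And>e. 0 < e \<Longrightarrow> \<exists>p. \<forall>i\<in>I. (\<integral>t. (poly p t - f t)\<^sup>2 \<partial>\<mu> i) < e) \<Longrightarrow> poly_approximable f"
  unfolding poly_approximable_def by blast

lemma poly_approximable_add:
  assumes "poly_approximable f" "poly_approximable g"
  shows "poly_approximable (\<lambda>t. f t + g t)"
proof -
  have [measurable]: "f \<in> borel_measurable borel" "g \<in> borel_measurable borel"
    using assms by (auto simp: poly_approximable_def)
  obtain B C where B: "\<And>t. \<bar>f t\<bar> \<le> B" and C: "\<And>t. \<bar>g t\<bar> \<le> C"
    using assms unfolding poly_approximable_def by metis
  have BC: "\<bar>f t + g t\<bar> \<le> B + C" for t
    using B[of t] C[of t] by linarith
  have "\<exists>r. \<forall>i\<in>I. (\<integral>t. (poly r t - (f t + g t))\<^sup>2 \<partial>\<mu> i) < e" if "0 < e" for e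
  proof -
    from that have e4: "0 < e / 4" by simp
    obtain p where p: "\<forall>i\<in>I. (\<integral>t. (poly p t - f t)\<^sup>2 \<partial>\<mu> i) < e / 4"
      using poly_approximableD[OF assms(1) e4] ..
    obtain q where q: "\<forall>i\<in>I. (\<integral>t. (poly q t - g t)\<^sup>2 \<partial>\<mu> i) < e / 4"
      using poly_approximableD[OF assms(2) e4] ..
    show ?thesis
    proof (intro exI ballI)
      fix i assume i: "i \<in> I"
      have eq: "poly (p + q) t - (f t + g t) = (poly p t - f t) + (poly q t - g t)" for t by simp
      have "integrable (\<mu> i) (\<lambda>t. (poly (p + q) t - (f t + g t))\<^sup>2)"
        by (rule unit_interval_integrable_sq[OF \<mu>[OF i] _ BC]) measurable
      then have "(\<integral>t. (poly (p + q) t - (f t + g t))\<^sup>2 \<partial>\<mu> i) \<le>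
          2 * (\<integral>t. (poly p t - f t)\<^sup>2 \<partial>\<mu> i) + 2 * (\<integral>t. (poly q t - g t)\<^sup>2 \<partial>\<mu> i)"
        unfolding eq using \<mu>[OF i] B C
        by (intro integral_sq_add_le) (auto intro!: unit_interval_integrable_sq)
      with bspec[OF p i] bspec[OF q i] show "(\<integral>t. (poly (p + q) t - (f t + g t))\<^sup>2 \<partial>\<mu> i) < e" by linarith
    qed
  qed
  then show ?thesis by (intro poly_approximableI[OF _ BC]) measurable
qed

lemma poly_approximable_compl:
  assumes "poly_approximable f"
  shows "poly_approximable (\<lambda>t. 1 - f t)"
proof -
  have "\<exists>q. \<forall>i\<in>I. (\<integral>t. (poly q t - (1 - f t))\<^sup>2 \<partial>\<mu> i) < e" if "0 < e" for e
  proof -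
    from that assms obtain p where "\<forall>i\<in>I. (\<integral>t. (poly p t - f t)\<^sup>2 \<partial>\<mu> i) < e"
      by (auto simp: poly_approximable_def)
    moreover have "(poly (1 - p) t - (1 - f t))\<^sup>2 = (poly p t - f t)\<^sup>2" for t
      by (simp add: power2_commute)
    ultimately show ?thesis by (intro exI[of _ "1 - p"]) simp
  qed
  moreover obtain B where B: "\<And>t. \<bar>f t\<bar> \<le> B" using assms unfolding poly_approximable_def by metis
  have "\<bar>1 - f t\<bar> \<le> 1 + B" for t
    using B[of t] by linarith
  moreover have [measurable]: "f \<in> borel_measurable borel" using assms by (simp add: poly_approximable_def)
  have "(\<lambda>t. 1 - f t) \<in> borel_measurable borel" by measurable
  ultimately show ?thesis by (intro poly_approximableI) measurable
qed

text \<open>Dominated convergence with a constant majorant brings some \<open>f n\<close> close to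
  \<open>g\<close> in quadratic mean, and \<open>f n\<close> is in turn close to a
  polynomial.\<close>

lemma poly_approximable_limit:
  assumes f: "\<And>n. poly_approximable (f n)" and lim: "\<And>t. (\<lambda>n. f n t) \<longlonglongrightarrow> g t"
    and B: "\<And>n t. \<bar>f n t\<bar> \<le> B"
  shows "poly_approximable g"
proof -
  have [measurable]: "f n \<in> borel_measurable borel" for n
    using f by (simp add: poly_approximable_def)
  have g[measurable]: "g \<in> borel_measurable borel"
    by (rule borel_measurable_LIMSEQ_real[OF lim]) measurable
  have Bg: "\<bar>g t\<bar> \<le> B" for t
    using tendsto_rabs[OF lim] by (rule LIMSEQ_le_const2) (use B in blast)
  have diff: "\<bar>f n t - g t\<bar> \<le> 2 * B" for n t
    using B[of n t] Bg[of t] by linarith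
  have "\<exists>p. \<forall>i\<in>I. (\<integral>t. (poly p t - g t)\<^sup>2 \<partial>\<mu> i) < e" if "0 < e" for e
  proof -
    have "(\<lambda>n. \<integral>t. (f n t - g t)\<^sup>2 \<partial>\<mu> i) \<longlonglongrightarrow> (\<integral>t. 0 \<partial>\<mu> i)" if "i \<in> I" for i
    proof (rule integral_dominated_convergence[where w = "\<lambda>_. (2 * B)\<^sup>2"])
      have [measurable_cong]: "sets (\<mu> i) = sets borel" and "finite_measure (\<mu> i)"
        using \<mu>[OF that] by (simp_all add: unit_interval_measure_def)
      then show "integrable (\<mu> i) (\<lambda>_. (2 * B)\<^sup>2)" by (simp add: finite_measure.integrable_const)
      show "(\<lambda>t. (f n t - g t)\<^sup>2) \<in> borel_measurable (\<mu> i)" for n by measurable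
      show "AE t in \<mu> i. (\<lambda>n. (f n t - g t)\<^sup>2) \<longlonglongrightarrow> 0"
        using tendsto_power[OF LIM_zero[OF lim], where n = 2] by simp
      show "AE t in \<mu> i. norm ((f n t - g t)\<^sup>2) \<le> (2 * B)\<^sup>2" for n
        using power_mono[OF diff, of n _ 2] by simp
    qed simp
    then have "\<forall>i\<in>I. \<forall>\<^sub>F n in sequentially. (\<integral>t. (f n t - g t)\<^sup>2 \<partial>\<mu> i) < e / 4"
      using that by (auto intro!: order_tendstoD(2))
    \<comment> \<open>Finiteness of \<open>I\<close> yields one \<open>n\<close> for all
      measures.\<close>
    then have "\<forall>\<^sub>F n in sequentially. \<forall>i\<in>I. (\<integral>t. (f n t - g t)\<^sup>2 \<partial>\<mu> i) < e / 4"
      by (intro eventually_ball_finite fin)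
    then obtain n where n: "\<forall>i\<in>I. (\<integral>t. (f n t - g t)\<^sup>2 \<partial>\<mu> i) < e / 4"
      using eventually_happens by force
    from that have e4: "0 < e / 4" by simp
    obtain p where p: "\<forall>i\<in>I. (\<integral>t. (poly p t - f n t)\<^sup>2 \<partial>\<mu> i) < e / 4"
      using poly_approximableD[OF f[of n] e4] ..
    show ?thesis
    proof (intro exI ballI)
      fix i assume i: "i \<in> I"
      have eq: "poly p t - g t = (poly p t - f n t) + (f n t - g t)" for t by simp
      have "integrable (\<mu> i) (\<lambda>t. (poly p t - g t)\<^sup>2)"
        using \<mu>[OF i] g Bg by (rule unit_interval_integrable_sq)
      moreover have "integrable (\<mu> i) (\<lambda>t. (poly 0 t - (f n t - g t))\<^sup>2)"
        using \<mu>[OF i] diff by (intro unit_interval_integrable_sq) auto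
      ultimately have "(\<integral>t. (poly p t - g t)\<^sup>2 \<partial>\<mu> i) \<le>
          2 * (\<integral>t. (poly p t - f n t)\<^sup>2 \<partial>\<mu> i) + 2 * (\<integral>t. (f n t - g t)\<^sup>2 \<partial>\<mu> i)"
        unfolding eq using \<mu>[OF i] B
        by (intro integral_sq_add_le) (auto intro!: unit_interval_integrable_sq simp: power2_commute)
      with bspec[OF p i] bspec[OF n i] show "(\<integral>t. (poly p t - g t)\<^sup>2 \<partial>\<mu> i) < e" by linarith
    qed
  qed
  then show ?thesis by (rule poly_approximableI[OF g Bg])
qed

text \<open>Uniform approximation on [0, 1] by Stone-Weierstrass bounds the quadratic mean, since
  the measures are finite and carried by [0, 1].\<close>

lemma poly_approximable_continuous:
  assumes cont: "continuous_on UNIV f" and B: "\<And>t. \<bar>f t\<bar> \<le> B"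
  shows "poly_approximable f"
proof -
  have f[measurable]: "f \<in> borel_measurable borel" using cont by (rule borel_measurable_continuous_onI)
  have "\<exists>p. \<forall>i\<in>I. (\<integral>t. (poly p t - f t)\<^sup>2 \<partial>\<mu> i) < e" if e: "0 < e" for e
  proof -
    \<comment> \<open>\<open>C\<close> exceeds the mass of every measure, and the summand 1 keeps it
      positive even if all masses are 0. Then \<open>d\<close> is chosen with
      \<open>d\<^sup>2 * C = e\<close>.\<close>
    define C where "C = (\<Sum>i\<in>I. measure (\<mu> i) (space (\<mu> i))) + 1"
    have C: "0 < C" unfolding C_def by (intro add_nonneg_pos sum_nonneg) auto
    define d where "d = sqrt (e / C)"
    have d: "0 < d" using e C by (simp add: d_def)
    obtain g where "real_polynomial_function g" and g: "\<And>t. t \<in> {0..1} \<Longrightarrow> \<bar>f t - g t\<bar> < d"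
      using Stone_Weierstrass_real_polynomial_function[OF compact_Icc continuous_on_subset[OF cont subset_UNIV] d]
      by metis
    then obtain a n where "g = (\<lambda>t. \<Sum>i\<le>n. a i * t ^ i)"
      unfolding real_polynomial_function_iff_sum by blast
    then have "g = poly (\<Sum>i\<le>n. monom (a i) i)"
      by (simp add: fun_eq_iff poly_sum poly_monom)
    then obtain p where p: "\<And>t. t \<in> {0..1} \<Longrightarrow> \<bar>poly p t - f t\<bar> < d"
      using g by (metis abs_minus_commute)
    show ?thesis
    proof (intro exI ballI)
      fix i assume i: "i \<in> I"
      interpret finite_measure "\<mu> i" using \<mu>[OF i] by (simp add: unit_interval_measure_def)
      have AE: "AE t in \<mu> i. t \<in> {0..1}" using \<mu>[OF i] by (simp add: unit_interval_measure_def)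
      have "(\<integral>t. (poly p t - f t)\<^sup>2 \<partial>\<mu> i) \<le> (\<integral>t. d\<^sup>2 \<partial>\<mu> i)"
      proof (rule integral_mono_AE)
        show "integrable (\<mu> i) (\<lambda>t. (poly p t - f t)\<^sup>2)"
          using \<mu>[OF i] f B by (rule unit_interval_integrable_sq)
        show "AE t in \<mu> i. (poly p t - f t)\<^sup>2 \<le> d\<^sup>2"
          using AE
        proof eventually_elim
          case (elim t)
          then show ?case using power_mono[OF less_imp_le[OF p], of t 2] by simp
        qed
      qed simp
      also have "\<dots> = e / C * measure (\<mu> i) (space (\<mu> i))" using e C by (simp add: d_def mult.commute)
      also have "\<dots> < e / C * C"
      proof (rule mult_strict_left_mono)
        have "measure (\<mu> i) (space (\<mu> i)) \<le> (\<Sum>i\<in>I. measure (\<mu> i) (space (\<mu> i)))"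
          using fin i by (intro member_le_sum) auto
        then show "measure (\<mu> i) (space (\<mu> i)) < C" by (simp add: C_def)
      qed (use e C in simp)
      also have "\<dots> = e" using C by simp
      finally show "(\<integral>t. (poly p t - f t)\<^sup>2 \<partial>\<mu> i) < e" .
    qed
  qed
  then show ?thesis by (rule poly_approximableI[OF f B])
qed

lemma poly_approximable_atMost: "poly_approximable (indicator {..a})"
proof (rule poly_approximable_limit)
  \<comment> \<open>For \<open>n > 0\<close> these are continuous ramps that fall from 1 at
    \<open>a\<close> to 0 at \<open>a + 1 / n\<close>.\<close>
  let ?f = "\<lambda>n t. max 0 (min 1 (1 - real n * (t - a)))"
  show "poly_approximable (?f n)" for n
    by (rule poly_approximable_continuous[of _ 1]) (auto intro!: continuous_intros)
  show "(\<lambda>n. ?f n t) \<longlonglongrightarrow> indicator {..a} t" for t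
  proof (cases "t \<le> a")
    case True
    then have "real n * (t - a) \<le> 0" for n by (simp add: mult_nonneg_nonpos)
    then have "?f n t = 1" for n by (simp add: max_def min_def)
    with True show ?thesis by simp
  next
    case False
    obtain m where m: "1 / (t - a) < real m" using reals_Archimedean2 by blast
    have "\<forall>\<^sub>F n in sequentially. ?f n t = 0"
      using eventually_ge_at_top[of m]
    proof eventually_elim
      case (elim n)
      then have "1 / (t - a) \<le> real n" using m by linarith
      with False show ?case by (simp add: field_simps max_def)
    qed
    then show ?thesis using False by (simp add: tendsto_eventually)
  qed
  show "\<bar>?f n t\<bar> \<le> 1" for n t by simp
qed

text \<open>The half-lines are stable under intersection and generate the Borel sets, so Dynkin's
  argument leaves complements and countable disjoint unions; the latter are limits of finite
  unions.\<close>

lemma poly_approximable_indicator: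
  assumes "\<Omega> \<in> sets borel"
  shows "poly_approximable (indicator \<Omega>)"
proof -
  have "Int_stable (range (\<lambda>a::real. {..a}))"
    by (rule Int_stableI_image) (metis Int_atMost UNIV_I)
  moreover have "range (\<lambda>a::real. {..a}) \<subseteq> Pow UNIV" by simp
  moreover have "\<Omega> \<in> sigma_sets UNIV (range (\<lambda>a::real. {..a}))"
    using assms unfolding borel_eq_atMost by simp
  ultimately show ?thesis
  proof (induction rule: sigma_sets_induct_disjoint)
    case (basic A)
    then show ?case by (auto intro: poly_approximable_atMost)
  next
    case empty
    show ?case by (rule poly_approximable_continuous[of _ 0]) auto
  next
    case (compl A)
    have "indicator (UNIV - A) = (\<lambda>t. 1 - indicator A t :: real)"
      by (simp add: fun_eq_iff split: split_indicator)
    then show ?case using poly_approximable_compl[OF compl.IH] by simp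
  next
    case (union A)
    have disj: "A n \<inter> (\<Union>k<n. A k) = {}" for n
      unfolding Int_UN_distrib using disjoint_family_onD[OF union(1), of n] by simp
    have fin_union: "poly_approximable (indicator (\<Union>k<n. A k))" for n
    proof (induction n)
      case 0
      show ?case by (rule poly_approximable_continuous[of _ 0]) auto
    next
      case (Suc n)
      have "indicator (\<Union>k<Suc n. A k) = (\<lambda>t. indicator (A n) t + indicator (\<Union>k<n. A k) t :: real)"
        using disj[of n] unfolding lessThan_Suc UN_insert by (intro ext indicator_add[symmetric])
      with poly_approximable_add[OF union.IH[of n] Suc.IH] show ?case by simp
    qed
    show ?case
    proof (rule poly_approximable_limit[OF fin_union])
      show "(\<lambda>n. indicator (\<Union>k<n. A k) t :: real) \<longlonglongrightarrow> indicator (\<Union>i. A i) t" for t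
        by (rule LIMSEQ_indicator_UN)
      show "\<bar>indicator (\<Union>k<n. A k) t :: real\<bar> \<le> 1" for n t by (simp split: split_indicator)
    qed
  qed
qed

lemma poly_L2_approximation:
  assumes "\<Omega> \<in> sets borel"
  obtains P where "\<And>i. i \<in> I \<Longrightarrow> (\<lambda>n. \<integral>t. (poly (P n) t - indicator \<Omega> t)\<^sup>2 \<partial>\<mu> i) \<longlonglongrightarrow> 0"
proof -
  define err where "err p i = (\<integral>t. (poly p t - indicator \<Omega> t)\<^sup>2 \<partial>\<mu> i)" for p i
  have "\<exists>p. \<forall>i\<in>I. err p i < 1 / Suc n" for n
    using poly_approximable_indicator[OF assms] unfolding poly_approximable_def err_def by simp
  then obtain P where P: "\<And>n i. i \<in> I \<Longrightarrow> err (P n) i < 1 / Suc n" by metis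
  have "(\<lambda>n. err (P n) i) \<longlonglongrightarrow> 0" if "i \<in> I" for i
  proof (rule tendsto_sandwich[OF _ _ tendsto_const LIMSEQ_Suc[OF lim_1_over_n]])
    show "\<forall>\<^sub>F n in sequentially. 0 \<le> err (P n) i" by (simp add: err_def)
    show "\<forall>\<^sub>F n in sequentially. err (P n) i \<le> 1 / of_nat (Suc n)"
      using P[OF that] by (simp add: less_imp_le)
  qed
  then show thesis unfolding err_def by (rule that)
qed

end

subsection \<open>Projection-valued measures\<close>

lemma pvm_projection: "projection_valued_measure E \<Longrightarrow> \<Omega> \<in> sets borel \<Longrightarrow> orthogonal_projection (E \<Omega>)"
  by (simp add: projection_valued_measure_def)

lemma pvm_sums:
  assumes "projection_valued_measure E" "range \<Omega> \<subseteq> sets borel" "disjoint_family \<Omega>"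
  shows "(\<lambda>n. E (\<Omega> n) x) sums E (\<Union>n. \<Omega> n) x"
  using assms unfolding projection_valued_measure_def by blast

text \<open>Additivity for the constant family of empty sets makes a constant series converge, so
  its terms vanish.\<close>

lemma pvm_empty:
  assumes "projection_valued_measure E"
  shows "E {} x = 0"
proof -
  have "(\<lambda>n :: nat. E {} x) sums E (\<Union>n :: nat. {}) x"
    by (rule pvm_sums[OF assms]) (auto simp: disjoint_family_on_def)
  then have "(\<lambda>n :: nat. E {} x) \<longlonglongrightarrow> 0" by (intro summable_LIMSEQ_zero sums_summable)
  then show ?thesis by (simp add: LIMSEQ_const_iff)
qed

lemma sums_Re_cinner:
  fixes f :: "nat \<Rightarrow> 'a::complex_hilbert_space"
  assumes "f sums y"
  shows "(\<lambda>n. Re (cinner (f n) x)) sums Re (cinner y x)"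
  using tendsto_Re_cinner[OF assms[unfolded sums_def], of x]
  unfolding sums_def cinner_sum_left Re_sum .

lemma space_scalar_measure [simp]: "space (scalar_measure E x) = UNIV"
  and sets_scalar_measure [simp, measurable_cong]: "sets (scalar_measure E x) = sets borel"
proof -
  show "space (scalar_measure E x) = UNIV" by (simp add: scalar_measure_def)
  have "sigma_sets UNIV (sets borel) = sets (borel :: real measure)"
    using sets.sigma_sets_eq[of "borel :: real measure"] by simp
  then show "sets (scalar_measure E x) = sets borel" by (simp add: scalar_measure_def)
qed

text \<open>\<open>measure_of\<close> takes the prescribed values only once countable additivity is
  known. It follows from continuity of the inner product, and the values are nonnegative as squared
  norms.\<close>

lemma emeasure_scalar_measure:
  assumes E: "projection_valued_measure E" and "\<Omega> \<in> sets borel"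
  shows "emeasure (scalar_measure E x) \<Omega> = ennreal (Re (cinner (E \<Omega> x) x))"
proof (rule emeasure_measure_of[OF scalar_measure_def])
  show "positive (sets (scalar_measure E x)) (\<lambda>\<Omega>. ennreal (Re (cinner (E \<Omega> x) x)))"
    by (simp add: positive_def pvm_empty[OF E])
  show "countably_additive (sets (scalar_measure E x)) (\<lambda>\<Omega>. ennreal (Re (cinner (E \<Omega> x) x)))"
  proof (rule countably_additiveI)
    fix A :: "nat \<Rightarrow> real set"
    assume A: "range A \<subseteq> sets (scalar_measure E x)" "disjoint_family A"
    then have "(\<lambda>n. Re (cinner (E (A n) x) x)) sums Re (cinner (E (\<Union>n. A n) x) x)"
      by (intro sums_Re_cinner pvm_sums[OF E]) simp_all
    moreover have "0 \<le> Re (cinner (E (A n) x) x)" for n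
    proof -
      have "A n \<in> sets borel" using A(1) by auto
      then show ?thesis by (simp add: orthogonal_projection_cinner[OF pvm_projection[OF E]])
    qed
    ultimately show "(\<Sum>n. ennreal (Re (cinner (E (A n) x) x))) = ennreal (Re (cinner (E (\<Union>n. A n) x) x))"
      by (intro suminf_ennreal_eq)
  qed
qed (use assms in simp_all)

lemma finite_measure_scalar_measure:
  "projection_valued_measure E \<Longrightarrow> finite_measure (scalar_measure E x)"
  by (rule finite_measureI) (simp add: emeasure_scalar_measure)

lemma measure_scalar_measure:
  assumes "projection_valued_measure E" "\<Omega> \<in> sets borel"
  shows "measure (scalar_measure E x) \<Omega> = Re (cinner (E \<Omega> x) x)"
  using assms orthogonal_projection_cinner[OF pvm_projection[OF assms], of x]
  by (simp add: measure_def emeasure_scalar_measure)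

lemma measure_scalar_measure_UNIV:
  assumes "projection_valued_measure E"
  shows "measure (scalar_measure E x) UNIV = (norm x)\<^sup>2"
proof -
  have "E UNIV x = x" using assms by (simp add: projection_valued_measure_def)
  then show ?thesis using measure_scalar_measure[OF assms, of UNIV x] by (simp add: Re_cinner_self)
qed

text \<open>Change of variables; it takes the spectral measure of a positive contraction to that of
  a general bounded self-adjoint operator.\<close>

lemma is_spectral_measure_affine:
  fixes A :: "'a::complex_hilbert_space \<Rightarrow> 'a"
  assumes "is_spectral_measure E A"
  shows "is_spectral_measure (\<lambda>\<Omega>. E ((\<lambda>t. a + b * t) -` \<Omega>)) (\<lambda>x. a *\<^sub>R x + b *\<^sub>R A x)"
proof -
  let ?f = "\<lambda>t::real. a + b * t" and ?E = "\<lambda>\<Omega>. E ((\<lambda>t. a + b * t) -` \<Omega>)"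
  have E: "projection_valued_measure E" using assms by (simp add: is_spectral_measure_def)
  have int: "integrable (scalar_measure E x) (\<lambda>t. t)"
    and eq: "cinner (A x) x = complex_of_real (\<integral>t. t \<partial>scalar_measure E x)" for x
    using assms by (simp_all add: is_spectral_measure_def)
  have f[measurable]: "?f \<in> borel_measurable borel" by measurable
  have vimage: "?f -` \<Omega> \<in> sets borel" if "\<Omega> \<in> sets borel" for \<Omega>
    using measurable_sets[OF f that] by simp
  have pvm: "projection_valued_measure ?E"
    unfolding projection_valued_measure_def
  proof (intro conjI ballI allI impI)
    show "orthogonal_projection (?E \<Omega>)" if "\<Omega> \<in> sets borel" for \<Omega>
      by (rule pvm_projection[OF E vimage[OF that]])
    show "?E UNIV = id" using E by (simp add: projection_valued_measure_def)
    show "(\<lambda>n. ?E (\<Omega> n) x) sums ?E (\<Union>n. \<Omega> n) x"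
      if "range \<Omega> \<subseteq> sets borel" "disjoint_family \<Omega>" for \<Omega> :: "nat \<Rightarrow> real set" and x
      unfolding vimage_UN
    proof (rule pvm_sums[OF E])
      show "range (\<lambda>n. ?f -` \<Omega> n) \<subseteq> sets borel" using that(1) vimage by blast
      show "disjoint_family (\<lambda>n. ?f -` \<Omega> n)" using that(2) unfolding disjoint_family_on_def by blast
    qed
  qed
  have distr: "scalar_measure ?E x = distr (scalar_measure E x) borel ?f" for x
  proof (rule measure_eqI)
    fix \<Omega> assume "\<Omega> \<in> sets (scalar_measure ?E x)"
    then have \<Omega>: "\<Omega> \<in> sets borel" by simp
    then show "emeasure (scalar_measure ?E x) \<Omega> = emeasure (distr (scalar_measure E x) borel ?f) \<Omega>"
      by (simp add: emeasure_distr emeasure_scalar_measure[OF pvm] emeasure_scalar_measure[OF E] vimage)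
  qed simp
  show ?thesis unfolding is_spectral_measure_def
  proof (intro conjI allI pvm)
    fix x
    interpret finite_measure "scalar_measure E x" by (rule finite_measure_scalar_measure[OF E])
    have f': "?f \<in> measurable (scalar_measure E x) borel" by measurable
    have "integrable (scalar_measure E x) ?f"
      using int[of x] by (intro Bochner_Integration.integrable_add integrable_mult_right) auto
    then show "integrable (scalar_measure ?E x) (\<lambda>t. t)"
      unfolding distr by (subst integrable_distr_eq[OF f']) simp_all
    have "(\<integral>t. t \<partial>scalar_measure ?E x) = (\<integral>t. a + b * t \<partial>scalar_measure E x)"
      unfolding distr by (rule integral_distr[OF f']) simp
    also have "\<dots> = a * (norm x)\<^sup>2 + b * (\<integral>t. t \<partial>scalar_measure E x)"
      using int[of x] measure_scalar_measure_UNIV[OF E, of x] by simp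
    finally show "cinner (a *\<^sub>R x + b *\<^sub>R A x) x = complex_of_real (\<integral>t. t \<partial>scalar_measure ?E x)"
      by (simp add: cinner_simps eq cinner_self)
  qed
qed

subsection \<open>The spectral measure of a positive contraction\<close>

text \<open>Cauchy-Schwarz against the constant function 1, from the nonnegativity of the integral
  of \<open>(v t - s)\<^sup>2\<close>. Adding 1 to the mass keeps the denominator of
  \<open>s\<close> positive.\<close>

lemma square_integral_le:
  assumes "finite_measure M" and v: "integrable M v" "integrable M (\<lambda>t. (v t)\<^sup>2 :: real)"
  shows "(\<integral>t. v t \<partial>M)\<^sup>2 \<le> (measure M (space M) + 1) * (\<integral>t. (v t)\<^sup>2 \<partial>M)"
proof -
  interpret finite_measure M by fact
  define c where "c = (\<integral>t. v t \<partial>M)"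
  define m where "m = measure M (space M)"
  define s where "s = c / (m + 1)"
  have m: "0 \<le> m" by (simp add: m_def)
  have "0 \<le> (\<integral>t. (v t - s)\<^sup>2 \<partial>M)" by simp
  also have "\<dots> = (\<integral>t. (v t)\<^sup>2 - 2 * s * v t + s\<^sup>2 \<partial>M)"
    by (simp add: power2_diff algebra_simps)
  also have "\<dots> = (\<integral>t. (v t)\<^sup>2 \<partial>M) - 2 * s * c + s\<^sup>2 * m"
    using v by (simp add: c_def m_def)
  finally have "2 * (s * c) - s\<^sup>2 * m \<le> (\<integral>t. (v t)\<^sup>2 \<partial>M)" by simp
  moreover have "c = s * (m + 1)" using m by (simp add: s_def)
  then have "s * c = s\<^sup>2 * m + s\<^sup>2" by (simp add: power2_eq_square algebra_simps)
  ultimately have "s * c \<le> (\<integral>t. (v t)\<^sup>2 \<partial>M)"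
    using zero_le_power2[of s] by linarith
  then have "(m + 1) * (s * c) \<le> (m + 1) * (\<integral>t. (v t)\<^sup>2 \<partial>M)"
    using m by (intro mult_left_mono) auto
  moreover have "(m + 1) * (s * c) = c\<^sup>2" using m by (simp add: s_def power2_eq_square)
  ultimately show ?thesis by (simp only: c_def m_def)
qed

locale positive_contraction = self_adjoint_op A for A :: "'a::complex_hilbert_space \<Rightarrow> 'a" +
  assumes pos: "\<And>x. 0 \<le> Re (cinner (A x) x)" and contr: "\<And>x. Re (cinner (A x) x) \<le> (norm x)\<^sup>2"
begin

lemma A_minus: "A (- x) = - A x"
  using A_simps(4)[of "-1" x] by simp

text \<open>Even powers are stripped off with \<open>pform_sandwich\<close>, so only the parities of
  \<open>k\<close> and \<open>l\<close> matter. The polynomials X and 1 - X are covered by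
  \<open>pos\<close> and \<open>contr\<close>, and their product by an identity.\<close>

lemma pform_monomial_nonneg: "0 \<le> pform x ([:0, 1:] ^ k * [:1, - 1:] ^ l)"
proof -
  let ?X = "[:0, 1:] :: real poly" and ?Y = "[:1, - 1:] :: real poly"
  have X: "0 \<le> pform x ?X" and Y: "0 \<le> pform x ?Y" for x
    using pos[of x] contr[of x] by (simp_all add: pform_def A_simps A_minus cinner_simps Re_cinner_self)
  have XY: "0 \<le> pform x (?X * ?Y)" for x
  proof -
    \<comment> \<open>This is \<open>?X * ?Y * (?X + ?Y)\<close> with \<open>?X + ?Y = 1\<close>;
      both summands have the form \<open>q * p * q\<close>.\<close>
    have "?X * ?Y * ?X + ?Y * ?X * ?Y = ?X * ?Y" by simp
    from arg_cong[OF this, of "pform x"]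
    have "pform x (?X * ?Y) = pform (poly_op A ?X x) ?Y + pform (poly_op A ?Y x) ?X"
      by (simp only: pform_add pform_sandwich)
    with X Y show ?thesis by simp
  qed
  have rest: "0 \<le> pform x (?X ^ (k mod 2) * ?Y ^ (l mod 2))" for x
    using X[of x] Y[of x] XY[of x] pform_one[of x]
    by (cases "even k"; cases "even l") (simp_all add: odd_iff_mod_2_eq_one even_iff_mod_2_eq_zero)
  define q where "q = ?X ^ (k div 2) * ?Y ^ (l div 2)"
  have split: "z ^ n = z ^ (n div 2) * z ^ (n mod 2) * z ^ (n div 2)" for z :: "real poly" and n
    unfolding power_add[symmetric] by (rule arg_cong[of _ _ "\<lambda>n. z ^ n"]) presburger
  have "?X ^ k * ?Y ^ l = q * (?X ^ (k mod 2) * ?Y ^ (l mod 2)) * q"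
    unfolding q_def using split[of ?X k] split[of ?Y l] by (simp only: mult_ac)
  then have "pform x (?X ^ k * ?Y ^ l) = pform (poly_op A q x) (?X ^ (k mod 2) * ?Y ^ (l mod 2))"
    by (simp only: pform_sandwich)
  with rest show ?thesis by simp
qed

text \<open>\<open>Hausdorff_moment\<close> wants the value 1 at the polynomial 1, so the functional
  is divided by \<open>(norm x)\<^sup>2\<close> and a constant density undoes this. For
  \<open>x = 0\<close> the functional is zero and the null measure represents it.\<close>

lemma ex_representing_measure:
  "\<exists>M. unit_interval_measure M \<and> (\<forall>p. pform x p = (\<integral>t. poly p t \<partial>M))"
proof (cases "x = 0")
  case True
  have "finite_measure (null_measure (borel :: real measure))" by (rule finite_measureI) simp
  moreover have "pform x p = 0" for p using True by (simp add: pform_def)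
  moreover have "AE t in null_measure borel. t \<in> {0..1::real}"
    by (rule AE_I'[of UNIV]) (auto simp: null_sets_def)
  ultimately show ?thesis
    by (intro exI[of _ "null_measure borel"]) (simp add: unit_interval_measure_def)
next
  case False
  define c where "c = (norm x)\<^sup>2"
  have c: "0 < c" using False by (simp add: c_def)
  obtain M where M: "real_distribution M" "AE t in M. t \<in> {0..1}"
    and int: "\<And>p. pform x p / c = (\<integral>t. poly p t \<partial>M)"
    by (rule Hausdorff_moment[of "\<lambda>p. pform x p / c"])
      (use c in \<open>auto simp: pform_add pform_smult pform_monomial_nonneg pform_one c_def add_divide_distrib\<close>)
  interpret real_distribution M by fact
  define M' where "M' = density M (\<lambda>_. ennreal c)"
  have "pform x p = (\<integral>t. poly p t \<partial>M')" for p
  proof -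
    have "(\<integral>t. poly p t \<partial>M') = (\<integral>t. c * poly p t \<partial>M)"
      unfolding M'_def using c by (subst integral_real_density) auto
    also have "\<dots> = pform x p" using int[of p] c by (simp add: field_simps)
    finally show ?thesis ..
  qed
  moreover have "finite_measure M'"
    by (rule finite_measureI) (simp add: M'_def emeasure_density_const ennreal_mult_eq_top_iff)
  moreover have "AE t in M'. t \<in> {0..1}"
    unfolding M'_def using M(2) by (subst AE_density) (auto elim: eventually_mono)
  moreover have "sets M' = sets borel" by (simp add: M'_def)
  ultimately show ?thesis unfolding unit_interval_measure_def by blast
qed

text \<open>The scalar spectral measure of \<open>x\<close>: \<open>spectral_measure_spec_op\<close>
  identifies it with \<open>scalar_measure spec_op x\<close>.\<close>

definition rep_measure :: "'a \<Rightarrow> real measure" where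
  "rep_measure x = (SOME M. unit_interval_measure M \<and> (\<forall>p. pform x p = (\<integral>t. poly p t \<partial>M)))"

lemma rep_measure: "unit_interval_measure (rep_measure x)"
  and pform_eq: "pform x p = (\<integral>t. poly p t \<partial>rep_measure x)"
  using someI_ex[OF ex_representing_measure[of x]] unfolding rep_measure_def by blast+

sublocale rep_measure: finite_measure "rep_measure x" for x
  using rep_measure[of x] by (simp add: unit_interval_measure_def)

lemma sets_rep_measure [simp, measurable_cong]: "sets (rep_measure x) = sets borel"
  using rep_measure[of x] by (simp add: unit_interval_measure_def)

lemma space_rep_measure [simp]: "space (rep_measure x) = UNIV"
  using sets_eq_imp_space_eq[OF sets_rep_measure] by simp

definition err :: "'a \<Rightarrow> real set \<Rightarrow> real poly \<Rightarrow> real" where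
  "err x \<Omega> p = (\<integral>t. (poly p t - indicator \<Omega> t)\<^sup>2 \<partial>rep_measure x)"

lemma integrable_err:
  assumes "\<Omega> \<in> sets borel"
  shows "integrable (rep_measure x) (\<lambda>t. (poly p t - indicator \<Omega> t)\<^sup>2)"
  by (rule unit_interval_integrable_sq[OF rep_measure, of _ 1]) (use assms in \<open>auto split: split_indicator\<close>)

text \<open>The left side is the integral of the squared difference of \<open>p\<close> and
  \<open>q\<close>. This isometry makes polynomials that approximate one indicator yield a Cauchy
  sequence of vectors.\<close>

lemma norm_poly_op_diff_le:
  assumes "\<Omega> \<in> sets borel"
  shows "(norm (poly_op A p x - poly_op A q x))\<^sup>2 \<le> 2 * err x \<Omega> p + 2 * err x \<Omega> q"
proof -
  have eq: "poly (p - q) t = (poly p t - indicator \<Omega> t) + (indicator \<Omega> t - poly q t)" for t by simp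
  have "(norm (poly_op A p x - poly_op A q x))\<^sup>2 = (\<integral>t. (poly (p - q) t)\<^sup>2 \<partial>rep_measure x)"
    by (simp add: norm_poly_op_sq pform_eq flip: poly_op_diff)
  also have "\<dots> \<le> 2 * (\<integral>t. (poly p t - indicator \<Omega> t)\<^sup>2 \<partial>rep_measure x) +
      2 * (\<integral>t. (indicator \<Omega> t - poly q t)\<^sup>2 \<partial>rep_measure x)"
    unfolding eq
  proof (rule integral_sq_add_le)
    show "integrable (rep_measure x) (\<lambda>t. (poly p t - indicator \<Omega> t)\<^sup>2)"
      and "integrable (rep_measure x) (\<lambda>t. (indicator \<Omega> t - poly q t)\<^sup>2)"
      using integrable_err[OF assms, of x] by (simp_all add: power2_commute)
    show "integrable (rep_measure x) (\<lambda>t. (poly p t - indicator \<Omega> t + (indicator \<Omega> t - poly q t))\<^sup>2)"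
      using unit_interval_integrable_poly[OF rep_measure, of x "(p - q)\<^sup>2"] by simp
  qed
  finally show ?thesis by (simp add: err_def power2_commute)
qed

definition approximates :: "(nat \<Rightarrow> real poly) \<Rightarrow> real set \<Rightarrow> 'a \<Rightarrow> bool" where
  "approximates P \<Omega> x \<longleftrightarrow> (\<lambda>n. err x \<Omega> (P n)) \<longlonglongrightarrow> 0"

lemma ex_approximates:
  assumes "finite X" "\<Omega> \<in> sets borel"
  obtains P where "\<And>x. x \<in> X \<Longrightarrow> approximates P \<Omega> x"
proof -
  interpret unit_interval_measures X rep_measure
    by unfold_locales (simp_all add: assms rep_measure)
  show thesis
    by (rule poly_L2_approximation[OF assms(2)], rule that) (simp add: approximates_def err_def)
qed

text \<open>The chosen sequence depends on \<open>x\<close>; \<open>tendsto_spec_op\<close> frees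
  the limit from this choice, so that several vectors can be treated with one sequence.\<close>

definition spec_op :: "real set \<Rightarrow> 'a \<Rightarrow> 'a" where
  "spec_op \<Omega> x = lim (\<lambda>n. poly_op A ((SOME P. approximates P \<Omega> x) n) x)"

lemma tendsto_spec_op:
  assumes \<Omega>: "\<Omega> \<in> sets borel" and P: "approximates P \<Omega> x"
  shows "(\<lambda>n. poly_op A (P n) x) \<longlonglongrightarrow> spec_op \<Omega> x"
proof -
  define Q where "Q = (SOME P. approximates P \<Omega> x)"
  have Q: "approximates Q \<Omega> x" unfolding Q_def using P by (rule someI[of "\<lambda>P. approximates P \<Omega> x"])
  have "Cauchy (\<lambda>n. poly_op A (Q n) x)"
  proof (rule metric_CauchyI)
    fix e :: real assume e: "0 < e"
    then have "\<forall>\<^sub>F n in sequentially. err x \<Omega> (Q n) < e\<^sup>2 / 4"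
      using Q unfolding approximates_def by (intro order_tendstoD(2)) auto
    then obtain N where N: "\<And>n. N \<le> n \<Longrightarrow> err x \<Omega> (Q n) < e\<^sup>2 / 4"
      unfolding eventually_sequentially by blast
    have "dist (poly_op A (Q m) x) (poly_op A (Q n) x) < e" if "N \<le> m" "N \<le> n" for m n
    proof -
      have "(dist (poly_op A (Q m) x) (poly_op A (Q n) x))\<^sup>2 < e\<^sup>2"
        using norm_poly_op_diff_le[OF \<Omega>, of "Q m" x "Q n"] N[OF that(1)] N[OF that(2)]
        by (simp add: dist_norm)
      then show ?thesis using e by (simp add: power2_less_imp_less)
    qed
    then show "\<exists>N. \<forall>m\<ge>N. \<forall>n\<ge>N. dist (poly_op A (Q m) x) (poly_op A (Q n) x) < e" by blast
  qed
  then have Q_lim: "(\<lambda>n. poly_op A (Q n) x) \<longlonglongrightarrow> spec_op \<Omega> x"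
    unfolding spec_op_def Q_def[symmetric] by (simp add: Cauchy_convergent_iff convergent_LIMSEQ_iff)
  \<comment> \<open>Both sequences approximate the same indicator, so the resulting vectors differ
    by a null sequence.\<close>
  have "(\<lambda>n. (norm (poly_op A (P n) x - poly_op A (Q n) x))\<^sup>2) \<longlonglongrightarrow> 0"
  proof (rule tendsto_sandwich[OF _ _ tendsto_const])
    show "(\<lambda>n. 2 * err x \<Omega> (P n) + 2 * err x \<Omega> (Q n)) \<longlonglongrightarrow> 0"
      using P Q unfolding approximates_def by (auto intro!: tendsto_eq_intros)
  qed (simp_all add: norm_poly_op_diff_le[OF \<Omega>])
  then have "(\<lambda>n. poly_op A (P n) x - poly_op A (Q n) x) \<longlonglongrightarrow> 0"
    by (simp add: tendsto_norm_zero_iff)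
  from tendsto_add[OF this Q_lim] show ?thesis by simp
qed

text \<open>One sequence that works for \<open>x\<close>, \<open>y\<close> and \<open>x + y\<close>
  lets additivity pass from polynomials to the limit.\<close>

lemma spec_op_add: "spec_op \<Omega> (x + y) = spec_op \<Omega> x + spec_op \<Omega> y" if \<Omega>: "\<Omega> \<in> sets borel"
proof -
  obtain P where P: "\<And>z. z \<in> {x, y, x + y} \<Longrightarrow> approximates P \<Omega> z"
    using ex_approximates[OF _ \<Omega>, of "{x, y, x + y}"] by blast
  have "(\<lambda>n. poly_op A (P n) (x + y)) \<longlonglongrightarrow> spec_op \<Omega> x + spec_op \<Omega> y"
    unfolding self_adjoint_add[OF self_adjoint_poly_op]
    by (intro tendsto_add tendsto_spec_op[OF \<Omega>] P) simp_all
  moreover have "(\<lambda>n. poly_op A (P n) (x + y)) \<longlonglongrightarrow> spec_op \<Omega> (x + y)"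
    by (intro tendsto_spec_op[OF \<Omega>] P) simp
  ultimately show ?thesis by (rule LIMSEQ_unique[THEN sym])
qed

lemma spec_op_cinner: "cinner (spec_op \<Omega> x) y = cinner x (spec_op \<Omega> y)" if \<Omega>: "\<Omega> \<in> sets borel"
proof -
  obtain P where P: "\<And>z. z \<in> {x, y} \<Longrightarrow> approximates P \<Omega> z"
    using ex_approximates[OF _ \<Omega>, of "{x, y}"] by blast
  have x: "(\<lambda>n. cinner (poly_op A (P n) x) y) \<longlonglongrightarrow> cinner (spec_op \<Omega> x) y"
    by (intro tendsto_cinner tendsto_spec_op[OF \<Omega>] P) simp
  \<comment> \<open>Conjugation swaps the arguments, as \<open>tendsto_cinner\<close> treats the
    first one.\<close>
  have "(\<lambda>n. cnj (cinner (poly_op A (P n) y) x)) \<longlonglongrightarrow> cnj (cinner (spec_op \<Omega> y) x)"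
    by (intro tendsto_cnj tendsto_cinner tendsto_spec_op[OF \<Omega>] P) simp
  then have "(\<lambda>n. cinner (poly_op A (P n) x) y) \<longlonglongrightarrow> cinner x (spec_op \<Omega> y)"
    unfolding cinner_commute[symmetric] self_adjoint_cinner[OF self_adjoint_poly_op] .
  with x show ?thesis by (rule LIMSEQ_unique)
qed

text \<open>Homogeneity follows from symmetry: the difference of the two sides is orthogonal to
  every vector, in particular to itself.\<close>

lemma spec_op_scaleC: "spec_op \<Omega> (c *\<^sub>C x) = c *\<^sub>C spec_op \<Omega> x" if \<Omega>: "\<Omega> \<in> sets borel"
proof -
  define z where "z = spec_op \<Omega> (c *\<^sub>C x) - c *\<^sub>C spec_op \<Omega> x"
  have "cinner z w = 0" for w
    by (simp add: z_def cinner_simps spec_op_cinner[OF \<Omega>])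
  from this[of z] show ?thesis by (simp add: z_def cinner_self)
qed

lemma self_adjoint_spec_op: "\<Omega> \<in> sets borel \<Longrightarrow> self_adjoint (spec_op \<Omega>)"
  by (rule self_adjointI) (simp_all add: spec_op_add spec_op_scaleC spec_op_cinner)

text \<open>Both quantities are limits along the approximants: the integrals of \<open>P n\<close>
  and of its square have the same limit because an indicator equals its square. Their equality feeds
  \<open>orthogonal_projectionI\<close>.\<close>

lemma
  assumes \<Omega>: "\<Omega> \<in> sets borel"
  shows norm_spec_op_sq: "(norm (spec_op \<Omega> x))\<^sup>2 = measure (rep_measure x) \<Omega>"
    and Re_cinner_spec_op: "Re (cinner (spec_op \<Omega> x) x) = measure (rep_measure x) \<Omega>"
proof -
  let ?M = "rep_measure x"
  obtain P where P: "approximates P \<Omega> x"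
    using ex_approximates[OF _ \<Omega>, of "{x}"] by blast
  define u where "u n t = poly (P n) t - indicator \<Omega> t" for n t
  have err0: "(\<lambda>n. \<integral>t. (u n t)\<^sup>2 \<partial>?M) \<longlonglongrightarrow> 0"
    using P by (simp add: approximates_def err_def u_def)
  have ind: "integrable ?M (indicator \<Omega> :: real \<Rightarrow> real)"
    using \<Omega> by (intro integrable_real_indicator) (simp_all add: rep_measure.emeasure_finite less_top[symmetric])
  have P_int: "integrable ?M (\<lambda>t. poly (P n) t)" for n
    by (rule unit_interval_integrable_poly[OF rep_measure])
  have u_sq: "integrable ?M (\<lambda>t. (u n t)\<^sup>2)" for n
    unfolding u_def by (rule integrable_err[OF \<Omega>])
  have u_int: "integrable ?M (u n)" for n
    unfolding u_def using P_int ind by (intro Bochner_Integration.integrable_diff)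
  \<comment> \<open>Chosen so that the square of \<open>P n\<close> is \<open>P n\<close> plus
    \<open>(u n t)\<^sup>2 + v n t\<close>. The factor in front of \<open>u\<close> is 1 or -1, so
    \<open>lim0\<close> applies to \<open>v\<close> as well as to \<open>u\<close>.\<close>
  define v where "v n t = (2 * indicator \<Omega> t - 1) * u n t" for n t
  have v_eq: "v n t = 2 * (indicator \<Omega> t * u n t) - u n t" for n t
    by (simp add: v_def algebra_simps)
  have v_int: "integrable ?M (v n)" for n
    unfolding v_eq using u_int integrable_mult_indicator[OF _ u_int, of \<Omega>] \<Omega> by simp
  have v_sq: "(v n t)\<^sup>2 = (u n t)\<^sup>2" for n t
    by (simp add: v_def power_mult_distrib split: split_indicator)
  have lim0: "(\<lambda>n. \<integral>t. w n t \<partial>?M) \<longlonglongrightarrow> 0"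
    if "\<And>n. integrable ?M (w n)" and w: "\<And>n t. (w n t)\<^sup>2 = (u n t)\<^sup>2" for w :: "nat \<Rightarrow> real \<Rightarrow> real"
  proof -
    have "(\<lambda>n. (\<integral>t. w n t \<partial>?M)\<^sup>2) \<longlonglongrightarrow> 0"
    proof (rule tendsto_sandwich[OF _ _ tendsto_const])
      show "(\<lambda>n. (measure ?M (space ?M) + 1) * (\<integral>t. (u n t)\<^sup>2 \<partial>?M)) \<longlonglongrightarrow> 0"
        using tendsto_mult[OF tendsto_const err0] by simp
      show "\<forall>\<^sub>F n in sequentially. (\<integral>t. w n t \<partial>?M)\<^sup>2 \<le> (measure ?M (space ?M) + 1) * (\<integral>t. (u n t)\<^sup>2 \<partial>?M)"
        using square_integral_le[OF rep_measure.finite_measure_axioms that(1)] u_sq by (simp add: w)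
    qed simp
    then show ?thesis by simp
  qed
  have "(\<lambda>n. (\<integral>t. u n t \<partial>?M) + measure ?M \<Omega>) \<longlonglongrightarrow> 0 + measure ?M \<Omega>"
    by (intro tendsto_add tendsto_const lim0 u_int refl)
  also have "(\<lambda>n. (\<integral>t. u n t \<partial>?M) + measure ?M \<Omega>) = (\<lambda>n. pform x (P n))"
    using P_int ind \<Omega> by (simp add: u_def pform_eq)
  finally have 1: "(\<lambda>n. pform x (P n)) \<longlonglongrightarrow> measure ?M \<Omega>" by simp
  have "(\<lambda>n. pform x (P n)) \<longlonglongrightarrow> Re (cinner (spec_op \<Omega> x) x)"
    unfolding pform_def by (intro tendsto_Re_cinner tendsto_spec_op \<Omega> P)
  with 1 show "Re (cinner (spec_op \<Omega> x) x) = measure ?M \<Omega>" by (rule LIMSEQ_unique[THEN sym])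
  have sq: "pform x ((P n)\<^sup>2) = pform x (P n) + ((\<integral>t. (u n t)\<^sup>2 \<partial>?M) + (\<integral>t. v n t \<partial>?M))" for n
  proof -
    have eq: "poly ((P n)\<^sup>2) t = poly (P n) t + ((u n t)\<^sup>2 + v n t)" for t
      by (simp add: u_def v_def power2_eq_square algebra_simps split: split_indicator)
    show ?thesis unfolding pform_eq eq using P_int u_sq v_int by simp
  qed
  have "(\<lambda>n. pform x ((P n)\<^sup>2)) \<longlonglongrightarrow> measure ?M \<Omega> + (0 + 0)"
    unfolding sq by (intro tendsto_add 1 err0 lim0 v_int v_sq)
  moreover have "(\<lambda>n. pform x ((P n)\<^sup>2)) \<longlonglongrightarrow> (norm (spec_op \<Omega> x))\<^sup>2"
    unfolding norm_poly_op_sq[symmetric] by (intro tendsto_power tendsto_norm tendsto_spec_op \<Omega> P)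
  ultimately show "(norm (spec_op \<Omega> x))\<^sup>2 = measure ?M \<Omega>"
    using LIMSEQ_unique by fastforce
qed

text \<open>Indicators of disjoint sets add up, so sums of approximants approximate the indicator of
  the union.\<close>

lemma spec_op_Un:
  assumes \<Omega>: "\<Omega> \<in> sets borel" "\<Omega>' \<in> sets borel" and disj: "\<Omega> \<inter> \<Omega>' = {}"
  shows "spec_op (\<Omega> \<union> \<Omega>') x = spec_op \<Omega> x + spec_op \<Omega>' x"
proof -
  obtain P where P: "approximates P \<Omega> x"
    using ex_approximates[OF _ \<Omega>(1), of "{x}"] by blast
  obtain Q where Q: "approximates Q \<Omega>' x"
    using ex_approximates[OF _ \<Omega>(2), of "{x}"] by blast
  have le: "err x (\<Omega> \<union> \<Omega>') (P n + Q n) \<le> 2 * err x \<Omega> (P n) + 2 * err x \<Omega>' (Q n)" for n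
  proof -
    have eq: "poly (P n + Q n) t - indicator (\<Omega> \<union> \<Omega>') t =
        (poly (P n) t - indicator \<Omega> t) + (poly (Q n) t - indicator \<Omega>' t)" for t
      using disj by (simp flip: indicator_add)
    show ?thesis
      unfolding err_def eq
      by (intro integral_sq_add_le integrable_err \<Omega> integrable_err[OF sets.Un[OF \<Omega>], of x "P n + Q n", unfolded eq])
  qed
  have "(\<lambda>n. err x (\<Omega> \<union> \<Omega>') (P n + Q n)) \<longlonglongrightarrow> 0"
  proof (rule tendsto_sandwich[OF _ _ tendsto_const])
    show "(\<lambda>n. 2 * err x \<Omega> (P n) + 2 * err x \<Omega>' (Q n)) \<longlonglongrightarrow> 0"
      using P Q unfolding approximates_def by (auto intro!: tendsto_eq_intros)
  qed (simp_all add: le, simp add: err_def)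
  then have "(\<lambda>n. poly_op A (P n + Q n) x) \<longlonglongrightarrow> spec_op (\<Omega> \<union> \<Omega>') x"
    using \<Omega> by (intro tendsto_spec_op) (simp_all add: approximates_def)
  moreover have "(\<lambda>n. poly_op A (P n + Q n) x) \<longlonglongrightarrow> spec_op \<Omega> x + spec_op \<Omega>' x"
    unfolding poly_op_add by (intro tendsto_add tendsto_spec_op \<Omega> P Q)
  ultimately show ?thesis by (rule LIMSEQ_unique)
qed

lemma spec_op_UNIV: "spec_op UNIV x = x"
proof -
  have "approximates (\<lambda>_. 1) UNIV x" by (simp add: approximates_def err_def)
  then have "(\<lambda>n. poly_op A 1 x) \<longlonglongrightarrow> spec_op UNIV x" by (intro tendsto_spec_op) simp_all
  then show ?thesis by (simp add: LIMSEQ_const_iff)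
qed

lemma spec_op_empty: "spec_op {} x = 0"
  using norm_spec_op_sq[of "{}" x] by simp

text \<open>Partial sums are the values on the finite unions \<open>W n\<close>. Their squared
  distance to the value on \<open>U\<close> is the measure of \<open>U - W n\<close>, which tends to
  0 by continuity from below.\<close>

lemma spec_op_sums:
  assumes \<Omega>: "range \<Omega> \<subseteq> sets borel" and disj: "disjoint_family (\<Omega> :: nat \<Rightarrow> real set)"
  shows "(\<lambda>n. spec_op (\<Omega> n) x) sums spec_op (\<Union>n. \<Omega> n) x"
proof -
  have \<Omega>n: "\<Omega> n \<in> sets borel" for n using \<Omega> by auto
  define U where "U = (\<Union>n. \<Omega> n)"
  define W where "W n = (\<Union>k<n. \<Omega> k)" for n
  have WB: "W n \<in> sets borel" "U \<in> sets borel" for n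
    unfolding W_def U_def using \<Omega>n by (auto intro!: sets.finite_UN sets.countable_UN)
  have WU: "W n \<subseteq> U" for n unfolding W_def U_def by blast
  have partial: "(\<Sum>k<n. spec_op (\<Omega> k) x) = spec_op (W n) x" for n
  proof (induction n)
    case 0
    show ?case by (simp add: W_def spec_op_empty)
  next
    case (Suc n)
    have "\<Omega> n \<inter> W n = {}"
      unfolding W_def Int_UN_distrib using disjoint_family_onD[OF disj, of n] by simp
    then have "spec_op (W n \<union> \<Omega> n) x = spec_op (W n) x + spec_op (\<Omega> n) x"
      by (intro spec_op_Un WB \<Omega>n) blast
    then show ?case using Suc by (simp add: W_def lessThan_Suc Un_commute)
  qed
  have "(\<lambda>n. measure (rep_measure x) (W n)) \<longlonglongrightarrow> measure (rep_measure x) (\<Union>n. W n)"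
  proof (rule rep_measure.finite_Lim_measure_incseq)
    show "incseq W" unfolding incseq_def W_def by (intro allI impI UN_mono) auto
  qed (use WB in auto)
  moreover have "(\<Union>n. W n) = U" unfolding W_def U_def by (auto intro: lessI)
  ultimately have "(\<lambda>n. measure (rep_measure x) U - measure (rep_measure x) (W n)) \<longlonglongrightarrow> 0"
    by (auto intro!: tendsto_eq_intros)
  moreover have "(norm (spec_op (W n) x - spec_op U x))\<^sup>2 = measure (rep_measure x) U - measure (rep_measure x) (W n)" for n
  proof -
    have "spec_op (W n \<union> (U - W n)) x = spec_op (W n) x + spec_op (U - W n) x"
      by (intro spec_op_Un) (use WB in auto)
    moreover have "W n \<union> (U - W n) = U" using WU by blast
    ultimately have "spec_op U x - spec_op (W n) x = spec_op (U - W n) x" by simp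
    then show ?thesis
      using norm_spec_op_sq[of "U - W n" x] WB rep_measure.finite_measure_Diff[of U x "W n"] WU
      by (simp add: norm_minus_commute)
  qed
  ultimately have "(\<lambda>n. (norm (spec_op (W n) x - spec_op U x))\<^sup>2) \<longlonglongrightarrow> 0" by simp
  then have "(\<lambda>n. spec_op (W n) x - spec_op U x) \<longlonglongrightarrow> 0" by (simp add: tendsto_norm_zero_iff)
  then show ?thesis unfolding sums_def partial U_def[symmetric] by (rule LIM_zero_cancel)
qed

theorem spectral_measure_spec_op: "is_spectral_measure spec_op A"
proof -
  have proj: "orthogonal_projection (spec_op \<Omega>)" if "\<Omega> \<in> sets borel" for \<Omega>
    by (rule orthogonal_projectionI)
      (simp_all add: that self_adjoint_spec_op norm_spec_op_sq Re_cinner_spec_op)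
  have pvm: "projection_valued_measure spec_op"
    unfolding projection_valued_measure_def
    using proj spec_op_sums by (auto simp: spec_op_UNIV fun_eq_iff)
  have scalar: "scalar_measure spec_op x = rep_measure x" for x
    by (rule measure_eqI)
      (simp_all add: emeasure_scalar_measure[OF pvm] Re_cinner_spec_op rep_measure.emeasure_eq_measure)
  have "integrable (rep_measure x) (\<lambda>t. t)" for x
    using unit_interval_integrable_poly[OF rep_measure, of x "[:0, 1:]"] by simp
  \<comment> \<open>The representation of \<open>pform\<close> at the polynomial
    \<open>[:0, 1:]\<close>.\<close>
  moreover have "cinner (A x) x = complex_of_real (\<integral>t. t \<partial>rep_measure x)" for x
    using self_adjoint_cinner_real[OF sa, of x] pform_eq[of x "[:0, 1:]"]
    by (simp add: pform_def A_simps)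
  ultimately show ?thesis unfolding is_spectral_measure_def scalar using pvm by blast
qed

end

theorem ex_spectral_measure:
  fixes T :: "'a::complex_hilbert_space \<Rightarrow> 'a"
  assumes sa: "self_adjoint T" and bound: "\<And>x. norm (T x) \<le> K * norm x"
  shows "\<exists>E. is_spectral_measure E T"
proof -
  \<comment> \<open>Positive even when \<open>K\<close> is not.\<close>
  define C where "C = max K 1"
  have C: "0 < C" "K \<le> C" by (simp_all add: C_def)
  \<comment> \<open>The form of \<open>T\<close> lies between \<open>- C\<close> and
    \<open>C\<close> times the squared norm, so shifting by \<open>C\<close> and dividing by
    \<open>2 * C\<close> gives a positive contraction.\<close>
  define A where "A x = (1 / (2 * C)) *\<^sub>R (T x + C *\<^sub>R x)" for x
  have "\<bar>Re (cinner (T x) x)\<bar> \<le> C * (norm x)\<^sup>2" for x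
  proof -
    have "\<bar>Re (cinner (T x) x)\<bar> \<le> norm (T x) * norm x" by (rule abs_Re_cinner_le)
    also have "\<dots> \<le> (C * norm x) * norm x"
      using bound[of x] C by (intro mult_right_mono order_trans[OF bound]) auto
    finally show ?thesis by (simp add: power2_eq_square)
  qed
  then have T: "- (C * (norm x)\<^sup>2) \<le> Re (cinner (T x) x)" "Re (cinner (T x) x) \<le> C * (norm x)\<^sup>2" for x
    by (simp_all add: abs_le_iff minus_le_iff)
  have ReA: "Re (cinner (A x) x) = (Re (cinner (T x) x) + C * (norm x)\<^sup>2) / (2 * C)" for x
    by (simp add: A_def cinner_simps Re_cinner_self)
  interpret positive_contraction A
  proof
    show "self_adjoint A"
    proof (rule self_adjointI)
      show "A (x + y) = A x + A y" for x y
        by (simp add: A_def self_adjoint_add[OF sa] algebra_simps)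
      show "A (c *\<^sub>C x) = c *\<^sub>C A x" for c x
        by (simp add: A_def self_adjoint_scaleC[OF sa] scaleC_add_right scaleC_scaleC mult.commute flip: scaleC_of_real)
      show "cinner (A x) y = cinner x (A y)" for x y
        by (simp add: A_def cinner_simps self_adjoint_cinner[OF sa])
    qed
    show "0 \<le> Re (cinner (A x) x)" "Re (cinner (A x) x) \<le> (norm x)\<^sup>2" for x
      unfolding ReA using T[of x] C by (simp_all add: field_simps)
  qed
  have "(- C) *\<^sub>R x + (2 * C) *\<^sub>R A x = T x" for x using C by (simp add: A_def)
  then show ?thesis
    using is_spectral_measure_affine[OF spectral_measure_spec_op, of "- C" "2 * C"] by auto
qed

subsection \<open>Finite-rank operators are bounded\<close>

definition orthonormal :: "'a::complex_hilbert_space set \<Rightarrow> bool" where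
  "orthonormal C \<longleftrightarrow> (\<forall>c\<in>C. \<forall>d\<in>C. cinner c d = (if c = d then 1 else 0))"

lemma orthonormal_cinner:
  "orthonormal C \<Longrightarrow> c \<in> C \<Longrightarrow> d \<in> C \<Longrightarrow> cinner c d = (if c = d then 1 else 0)"
  unfolding orthonormal_def by blast

lemma orthonormal_norm:
  assumes "orthonormal C" "c \<in> C"
  shows "norm c = 1"
  using Re_cinner_self[of c] orthonormal_cinner[OF assms assms(2)] power2_eq_imp_eq[of "norm c" 1]
  by simp

lemma cinner_orthonormal_sum:
  assumes "finite C" "orthonormal C" "d \<in> C"
  shows "cinner (\<Sum>c\<in>C. u c *\<^sub>C c) d = u d"
proof -
  have "cinner (\<Sum>c\<in>C. u c *\<^sub>C c) d = (\<Sum>c\<in>C. if c = d then u d else 0)"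
    unfolding cinner_sum_left
    by (intro sum.cong refl) (simp add: cinner_scaleC_left orthonormal_cinner[OF assms(2) _ assms(3)])
  then show ?thesis using assms by simp
qed

text \<open>Gram-Schmidt: the residual \<open>r\<close> of a new vector either vanishes or is
  normalized and joins the family.\<close>

lemma ex_orthonormal_span:
  fixes B :: "'a::complex_hilbert_space set"
  assumes "finite B"
  shows "\<exists>C. finite C \<and> orthonormal C \<and> B \<subseteq> cplx.span C"
  using assms
proof (induction B rule: finite_induct)
  case empty
  show ?case by (intro exI[of _ "{}"]) (simp add: orthonormal_def)
next
  case (insert b B)
  obtain C where C: "finite C" "orthonormal C" and BC: "B \<subseteq> cplx.span C"
    using insert.IH by blast
  define s where "s = (\<Sum>c\<in>C. cinner b c *\<^sub>C c)"
  define r where "r = b - s"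
  have s: "s \<in> cplx.span C" unfolding s_def by (intro cplx.span_sum cplx.span_scale cplx.span_base)
  have orth: "cinner r d = 0" if "d \<in> C" for d
    by (simp add: r_def s_def cinner_diff cinner_orthonormal_sum[OF C that])
  show ?case
  proof (cases "r = 0")
    case True
    then have "insert b B \<subseteq> cplx.span C" using s BC by (simp add: r_def)
    with C show ?thesis by blast
  next
    case False
    define e where "e = (1 / norm r) *\<^sub>R r"
    have "norm e = 1" using False by (simp add: e_def)
    then have e: "cinner e e = 1" by (simp add: cinner_self)
    have ortho: "cinner e d = 0" "cinner d e = 0" if "d \<in> C" for d
      using orth[OF that] cinner_commute[of d r] by (simp_all add: e_def cinner_simps)
    have mono: "cplx.span C \<subseteq> cplx.span (insert e C)" by (intro cplx.span_mono) blast
    have "b = s + complex_of_real (norm r) *\<^sub>C e"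
      using False by (simp add: e_def scaleC_of_real r_def)
    moreover have "s + complex_of_real (norm r) *\<^sub>C e \<in> cplx.span (insert e C)"
      by (intro cplx.span_add cplx.span_scale subsetD[OF mono s]) (simp add: cplx.span_base)
    moreover have "B \<subseteq> cplx.span (insert e C)"
      using BC mono by blast
    ultimately have "insert b B \<subseteq> cplx.span (insert e C)" by simp
    moreover have "orthonormal (insert e C)"
      using C(2) e ortho unfolding orthonormal_def by auto
    ultimately show ?thesis using C(1) by (intro exI[of _ "insert e C"]) simp
  qed
qed

lemma norm_le_sum_orthonormal:
  assumes "finite C" "orthonormal C" and "x \<in> cplx.span C"
  shows "norm x \<le> (\<Sum>c\<in>C. cmod (cinner x c))"
proof -
  from assms obtain u where x: "x = (\<Sum>c\<in>C. u c *\<^sub>C c)"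
    by (auto simp: cplx.span_finite)
  have u: "cinner x d = u d" if "d \<in> C" for d
    unfolding x by (rule cinner_orthonormal_sum[OF assms(1,2) that])
  have "norm x \<le> (\<Sum>c\<in>C. norm (u c *\<^sub>C c))" unfolding x by (rule norm_sum)
  also have "\<dots> = (\<Sum>c\<in>C. cmod (cinner x c))"
    by (intro sum.cong refl) (simp add: norm_scaleC orthonormal_norm[OF assms(2)] u)
  finally show ?thesis .
qed

text \<open>Needed to apply the spectral theorem to \<open>T + S\<close>. In a finite orthonormal
  set whose span contains the range, the coordinates of \<open>S x\<close> are
  \<open>cinner x (S c)\<close>, and Cauchy-Schwarz bounds each of them.\<close>

lemma self_adjoint_finite_rank_bounded:
  fixes S :: "'a::complex_hilbert_space \<Rightarrow> 'a"
  assumes S: "self_adjoint S" and "finite_cdim (range S)"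
  obtains K where "\<And>x. norm (S x) \<le> K * norm x"
proof -
  from assms(2) obtain B where B: "finite B" "range S \<subseteq> cplx.span B"
    by (auto simp: finite_cdim_def)
  obtain C where C: "finite C" "orthonormal C" and BC: "B \<subseteq> cplx.span C"
    using ex_orthonormal_span[OF B(1)] by blast
  have "cplx.span B \<subseteq> cplx.span C"
    using BC by (intro cplx.span_minimal cplx.subspace_span)
  then have span: "S x \<in> cplx.span C" for x using B(2) by blast
  have "norm (S x) \<le> (\<Sum>c\<in>C. norm (S c)) * norm x" for x
  proof -
    have "norm (S x) \<le> (\<Sum>c\<in>C. cmod (cinner (S x) c))"
      by (rule norm_le_sum_orthonormal[OF C span])
    also have "\<dots> \<le> (\<Sum>c\<in>C. norm x * norm (S c))"
      by (intro sum_mono) (simp add: self_adjoint_cinner[OF S] cmod_cinner_le)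
    finally show ?thesis by (simp add: mult.commute flip: sum_distrib_left)
  qed
  then show thesis by (rule that)
qed

subsection \<open>Half-line projections and quadratic forms\<close>

lemma pvm_atLeast:
  fixes E :: "real set \<Rightarrow> 'a::complex_hilbert_space \<Rightarrow> 'a"
  assumes E: "projection_valued_measure E"
  shows "measure (scalar_measure E x) {l..} = (norm x)\<^sup>2 - Re (cinner (E {..<l} x) x)"
proof -
  interpret finite_measure "scalar_measure E x" by (rule finite_measure_scalar_measure[OF E])
  have "{l..} = UNIV - {..<l}" by auto
  then show ?thesis
    using finite_measure_compl[of "{..<l}"]
    by (simp add: measure_scalar_measure_UNIV[OF E] measure_scalar_measure[OF E])
qed

text \<open>The scalar measure of \<open>x\<close> is carried by \<open>{..<l}\<close>, and its mass
  \<open>(norm x)\<^sup>2\<close> is positive, which makes the inequality strict.\<close>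

lemma quadratic_form_less:
  fixes X :: "'a::complex_hilbert_space \<Rightarrow> 'a"
  assumes X: "is_spectral_measure E X" and x: "E {..<l} x = x" "x \<noteq> 0"
  shows "Re (cinner (X x) x) < l * (norm x)\<^sup>2"
proof -
  let ?M = "scalar_measure E x"
  have E: "projection_valued_measure E" and int: "integrable ?M (\<lambda>t. t)"
    and eq: "Re (cinner (X x) x) = (\<integral>t. t \<partial>?M)"
    using X by (simp_all add: is_spectral_measure_def)
  interpret finite_measure ?M by (rule finite_measure_scalar_measure[OF E])
  have "measure ?M {l..} = 0" using x by (simp add: pvm_atLeast[OF E] Re_cinner_self)
  then have "{l..} \<in> null_sets ?M" by (simp add: null_sets_def emeasure_eq_measure)
  then have AE: "AE t in ?M. t < l" by (rule AE_I'[OF _ ]) (auto simp: not_less)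
  have "(\<integral>t. t \<partial>?M) < (\<integral>t. l \<partial>?M)"
  proof (rule integral_less_AE_space[OF int])
    have "0 < measure ?M (space ?M)" using x by (simp add: measure_scalar_measure_UNIV[OF E])
    then show "emeasure ?M (space ?M) \<noteq> 0" by (simp add: emeasure_eq_measure)
  qed (use AE in simp_all)
  then show ?thesis by (simp add: eq measure_scalar_measure_UNIV[OF E] mult.commute)
qed

text \<open>The scalar measure of \<open>x\<close> gives \<open>{..<l}\<close> no mass. It may
  charge the point \<open>l\<close> itself, so equality can occur.\<close>

lemma quadratic_form_ge:
  fixes X :: "'a::complex_hilbert_space \<Rightarrow> 'a"
  assumes X: "is_spectral_measure E X" and x: "E {..<l} x = 0"
  shows "l * (norm x)\<^sup>2 \<le> Re (cinner (X x) x)"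
proof -
  let ?M = "scalar_measure E x"
  have E: "projection_valued_measure E" and int: "integrable ?M (\<lambda>t. t)"
    and eq: "Re (cinner (X x) x) = (\<integral>t. t \<partial>?M)"
    using X by (simp_all add: is_spectral_measure_def)
  interpret finite_measure ?M by (rule finite_measure_scalar_measure[OF E])
  have "{..<l} \<in> null_sets ?M"
    using x by (simp add: null_sets_def emeasure_scalar_measure[OF E])
  then have AE: "AE t in ?M. l \<le> t" by (rule AE_I'[OF _ ]) (auto simp: not_le)
  have "(\<integral>t. l \<partial>?M) \<le> (\<integral>t. t \<partial>?M)"
    by (rule integral_mono_AE) (use int AE in simp_all)
  then show ?thesis by (simp add: eq measure_scalar_measure_UNIV[OF E] mult.commute)
qed

text \<open>Pairing the equation with \<open>x\<close> expresses \<open>(norm x)\<^sup>2\<close> as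
  a difference of squared norms. Since \<open>norm (P x)\<close> is at most \<open>norm x\<close>,
  the subtracted term must vanish.\<close>

lemma projection_diff_eq:
  fixes P Q :: "'a::complex_hilbert_space \<Rightarrow> 'a"
  assumes P: "orthogonal_projection P" and Q: "orthogonal_projection Q" and x: "P x - Q x = x"
  shows "P x = x \<and> Q x = 0"
proof -
  have lin: "(norm x)\<^sup>2 = (norm (P x))\<^sup>2 - (norm (Q x))\<^sup>2"
    using arg_cong[OF x, of "\<lambda>z. Re (cinner z x)"]
    by (simp add: cinner_diff orthogonal_projection_cinner[OF P] orthogonal_projection_cinner[OF Q] Re_cinner_self)
  have "0 \<le> (norm (P x - x))\<^sup>2" by simp
  also have "\<dots> = (norm x)\<^sup>2 - (norm (P x))\<^sup>2"
    by (simp add: norm_diff_sq orthogonal_projection_cinner[OF P])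
  finally have "(norm (Q x))\<^sup>2 \<le> 0" using lin by simp
  then have "Q x = 0" by simp
  with x show ?thesis by simp
qed

text \<open>\<open>S\<close> is injective on \<open>V\<close> and maps a basis of \<open>V\<close>
  to an independent subset of its range. Finiteness of the basis is a result of this comparison; it
  has to be established because \<open>cplx.dim\<close> is 0 in infinite dimension.\<close>

lemma cdim_le_of_Ker_trivial:
  fixes S :: "'a::complex_hilbert_space \<Rightarrow> 'a"
  assumes S: "self_adjoint S" and rank: "has_finite_rank S N"
    and V: "cplx.subspace V" and trivial: "\<And>x. x \<in> V \<Longrightarrow> S x = 0 \<Longrightarrow> x = 0"
  shows "cdim_le V N"
proof -
  interpret S: Vector_Spaces.linear scaleC scaleC S
    using S by (simp add: self_adjoint_def)
  obtain B0 where B0: "finite B0" "range S \<subseteq> cplx.span B0"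
    using rank by (auto simp: has_finite_rank_def finite_cdim_def)
  obtain R where R: "R \<subseteq> range S" "cplx.independent R" "range S \<subseteq> cplx.span R"
    and card_R: "card R = cplx.dim (range S)"
    by (rule cplx.basis_exists)
  have fin_R: "finite R"
    using cplx.independent_span_bound[OF B0(1) R(2)] R(1) B0(2) by blast
  obtain C where C: "C \<subseteq> V" "cplx.independent C" "V \<subseteq> cplx.span C"
    and card_C: "card C = cplx.dim V"
    by (rule cplx.basis_exists)
  have span_C: "cplx.span C \<subseteq> V" using C(1) V by (rule cplx.span_minimal)
  have inj: "inj_on S (cplx.span C)"
  proof (rule inj_onI)
    fix x y assume "x \<in> cplx.span C" "y \<in> cplx.span C" and eq: "S x = S y"
    then have "x - y \<in> V" using span_C cplx.span_diff by blast
    moreover have "S (x - y) = 0" using eq by (simp add: self_adjoint_diff[OF S])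
    ultimately show "x = y" using trivial by fastforce
  qed
  have "cplx.independent (S ` C)"
    using C(2) inj by (rule S.independent_injective_image)
  moreover have "S ` C \<subseteq> cplx.span R" using R(3) by blast
  ultimately have SC: "finite (S ` C)" "card (S ` C) \<le> card R"
    using cplx.independent_span_bound[OF fin_R] by blast+
  have inj_C: "inj_on S C" using inj cplx.span_superset by (rule inj_on_subset)
  have "finite C" using SC(1) inj_C by (rule finite_imageD)
  moreover have "cplx.dim V \<le> N"
    using SC(2) card_image[OF inj_C] card_C card_R rank by (simp add: has_finite_rank_def)
  ultimately show ?thesis using C(3) unfolding cdim_le_def finite_cdim_def by blast
qed

lemma subspace_projection_diff:
  fixes P Q :: "'a::complex_hilbert_space \<Rightarrow> 'a"
  assumes P: "self_adjoint P" and Q: "self_adjoint Q"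
  shows "cplx.subspace {x. P x - Q x = x}"
  unfolding cplx.subspace_def
  by (auto simp: self_adjoint_simps[OF P] self_adjoint_simps[OF Q] algebra_simps cplx.scale_right_diff_distrib[symmetric])

text \<open>At a vector of this space killed by \<open>S\<close> the forms of \<open>X\<close> and
  \<open>Y\<close> agree, although one lies below \<open>l * (norm x)\<^sup>2\<close> and the other
  does not. Exchanging \<open>X\<close> and \<open>Y\<close> will give the other sign.\<close>

lemma cdim_le_projection_diff:
  fixes X Y S :: "'a::complex_hilbert_space \<Rightarrow> 'a"
  assumes X: "is_spectral_measure E X" and Y: "is_spectral_measure F Y"
    and S: "self_adjoint S" "has_finite_rank S N" and agree: "\<And>x. S x = 0 \<Longrightarrow> X x = Y x"
  shows "cdim_le {x. E {..<l} x - F {..<l} x = x} N"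
proof (rule cdim_le_of_Ker_trivial[OF S])
  have E: "orthogonal_projection (E {..<l})" and F: "orthogonal_projection (F {..<l})"
    using X Y by (simp_all add: is_spectral_measure_def pvm_projection)
  then show "cplx.subspace {x. E {..<l} x - F {..<l} x = x}"
    by (intro subspace_projection_diff) (simp_all add: orthogonal_projection_def)
  fix x assume "x \<in> {x. E {..<l} x - F {..<l} x = x}" and Sx: "S x = 0"
  then have x: "E {..<l} x = x" "F {..<l} x = 0"
    using projection_diff_eq[OF E F] by blast+
  show "x = 0"
  proof (rule ccontr)
    assume "x \<noteq> 0"
    with quadratic_form_less[OF X x(1)] quadratic_form_ge[OF Y x(2)] agree[OF Sx]
    show False by simp
  qed
qed

theorem lemma3p1:
  fixes T S :: "'a::complex_hilbert_space \<Rightarrow> 'a"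
    and N :: nat
    and D :: "real \<Rightarrow> 'a \<Rightarrow> 'a"
  assumes "separable_space (euclidean :: 'a topology)"
    and "\<not> finite_cdim (UNIV :: 'a set)"
    and "bounded_linear T" and "self_adjoint T"
    and "self_adjoint S" and "has_finite_rank S N"
    and "\<And>l x. D l x = spectral_projection {..<l} (\<lambda>y. T y + S y) x
                      - spectral_projection {..<l} T x"
  shows "\<forall>l. cdim_le (Ker (\<lambda>x. D l x - x)) N \<and> cdim_le (Ker (\<lambda>x. D l x + x)) N"
proof -
  obtain K where K: "\<And>x. norm (T x) \<le> norm x * K"
    using bounded_linear.bounded[OF assms(3)] by blast
  obtain L where L: "\<And>x. norm (S x) \<le> L * norm x"
    using self_adjoint_finite_rank_bounded[OF assms(5)] assms(6) by (auto simp: has_finite_rank_def)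
  have TS: "self_adjoint (\<lambda>y. T y + S y)"
    by (rule self_adjointI)
      (simp_all add: self_adjoint_simps[OF assms(4)] self_adjoint_simps[OF assms(5)]
        scaleC_add_right cinner_simps)
  have "norm (T x + S x) \<le> (K + L) * norm x" for x
    using norm_triangle_ineq[of "T x" "S x"] K[of x] L[of x] by (simp add: algebra_simps)
  then have "\<exists>E. is_spectral_measure E (\<lambda>y. T y + S y)" by (rule ex_spectral_measure[OF TS])
  \<comment> \<open>Existence makes the \<open>SOME\<close> inside
    \<open>spectral_projection\<close> an actual spectral measure.\<close>
  then have E: "is_spectral_measure (SOME E. is_spectral_measure E (\<lambda>y. T y + S y)) (\<lambda>y. T y + S y)"
    by (rule someI_ex)
  have "\<exists>F. is_spectral_measure F T"
    using K by (intro ex_spectral_measure[OF assms(4), of K]) (simp add: mult.commute)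
  then have F: "is_spectral_measure (SOME F. is_spectral_measure F T) T" by (rule someI_ex)
  have minus: "Ker (\<lambda>x. D l x - x) = {x. spectral_projection {..<l} (\<lambda>y. T y + S y) x -
      spectral_projection {..<l} T x = x}" for l
    by (simp add: Ker_def assms(7))
  \<comment> \<open>The kernel for the plus sign is the one for the minus sign with \<open>T\<close>
    and \<open>T + S\<close> exchanged.\<close>
  have "(u - v + x = 0) = (v - u = x)" for u v x :: 'a
    by (metis add.commute add_diff_cancel_left' diff_add_cancel diff_eq_eq minus_diff_eq neg_eq_iff_add_eq_0)
  then have plus: "Ker (\<lambda>x. D l x + x) = {x. spectral_projection {..<l} T x -
      spectral_projection {..<l} (\<lambda>y. T y + S y) x = x}" for l
    by (simp add: Ker_def assms(7))
  show ?thesis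
    unfolding minus plus spectral_projection_def
    using cdim_le_projection_diff[OF E F assms(5,6)] cdim_le_projection_diff[OF F E assms(5,6)]
    by simp
qed

end
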